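(* (i) Let $\Lambda \subseteq \mathbb{C}$ be a sampling set for $\mathcal{F}^2$. For $\tau>0$ and $n \in \mathbb{N}$ let $\rho_n>0$ be defined by $\pi \rho_n^2 = n + \sqrt{n}\,\tau$, and let $B_{\rho_n} = \{z \in \mathbb{C} : |z| \le \rho_n\}$. Then for all $\tau>0$ large enough, the sets $\Lambda_n = \Lambda \cap B_{\rho_n}$ form a Marcinkiewicz-Zygmund family for $\mathcal{P}_n$ in $\mathcal{F}^2$. (ii) Conversely, if $(\Lambda_n)$ is a Marcinkiewicz-Zygmund family for $\mathcal{P}_n$ in $\mathcal{F}^2$, then every weak limit of $(\Lambda_n)$ is a sampling set for $\mathcal{F}^2$.
   Context: The Fock space $\mathcal{F}^2$ is the Hilbert space of all entire functions $f$ with finite norm $\|f\|_{\mathcal{F}^2} = \left(\int_{\mathbb{C}} |f(z)|^2 e^{-\pi |z|^2}\, dm(z)\right)^{1/2}$, where $dm$ is Lebesgue measure on $\mathbb{C} \simeq \mathbb{R}^2$. $\mathcal{P}_n$ denotes the space of holomorphic polynomials of degree at most $n$, with the inner product inherited from $\mathcal{F}^2$; its reproducing kernel is $k_n(z,w) = \sum_{k=0}^n \frac{(\pi z \bar w)^k}{k!}$. Sampling set: $\Lambda \subseteq \mathbb{C}$ is a sampling set for $\mathcal{F}^2$ if there are constants $A,B>0$ such that $A\|f\|_{\mathcal{F}^2}^2 \le \sum_{\lambda \in \Lambda} |f(\lambda)|^2 e^{-\pi|\lambda|^2} \le B \|f\|_{\mathcal{F}^2}^2$ for all $f \in \mathcal{F}^2$.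 Marcinkiewicz-Zygmund family: a sequence of finite subsets $\Lambda_n \subseteq \mathbb{C}$ is a Marcinkiewicz-Zygmund family for $\mathcal{P}_n$ in $\mathcal{F}^2$ if there exist constants $A,B>0$ and $n_0$ such that for all $n \ge n_0$, $A\|p\|_{\mathcal{F}^2}^2 \le \sum_{\lambda\in\Lambda_n} \frac{|p(\lambda)|^2}{k_n(\lambda,\lambda)} \le B\|p\|_{\mathcal{F}^2}^2$ for all $p \in \mathcal{P}_n$. Weak limit: a sequence of sets $\Lambda_n \subseteq \mathbb{C}$ converges weakly to $\Lambda \subseteq \mathbb{C}$ (and $\Lambda$ is a weak limit of $(\Lambda_n)$) if for all compact disks $B \subseteq \mathbb{C}$, $\lim_{n\to\infty} d\big((\Lambda_n\cap B)\cup \partial B, (\Lambda\cap B)\cup\partial B\big)=0$, where $d$ is the Hausdorff distance. *)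

theory Defs
  imports "HOL-Analysis.Analysis" "HOL-Computational_Algebra.Polynomial"
begin

definition fock_space :: "(complex \<Rightarrow> complex) set" where
  "fock_space = {f. f holomorphic_on UNIV \<and>
     integrable lborel (\<lambda>z. (cmod (f z))\<^sup>2 * exp (- pi * (cmod z)\<^sup>2))}"

text \<open>Only meaningful on \<open>fock_space\<close>, because the Bochner integral of a non-integrable
  function is 0.\<close>
definition fock_norm :: "(complex \<Rightarrow> complex) \<Rightarrow> real" where
  "fock_norm f = sqrt (LINT z|lborel. (cmod (f z))\<^sup>2 * exp (- pi * (cmod z)\<^sup>2))"

definition poly_space :: "nat \<Rightarrow> (complex \<Rightarrow> complex) set" where
  "poly_space n = {poly p | p. degree p \<le> n}"

definition poly_kernel :: "nat \<Rightarrow> complex \<Rightarrow> complex \<Rightarrow> complex" where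
  "poly_kernel n z w = (\<Sum>k\<le>n. (of_real pi * z * cnj w) ^ k / fact k)"

text \<open>The kernel is real on the diagonal, so taking \<open>Re\<close> there in \<open>marcinkiewicz_zygmund\<close>
  discards nothing.\<close>
lemma poly_kernel_diag:
  "poly_kernel n z z = of_real (\<Sum>k\<le>n. (pi * (cmod z)\<^sup>2) ^ k / fact k)"
proof -
  have "of_real pi * z * cnj z = of_real (pi * (cmod z)\<^sup>2)"
    by (simp only: mult.assoc complex_norm_square of_real_mult)
  then have "poly_kernel n z z = (\<Sum>k\<le>n. of_real (pi * (cmod z)\<^sup>2) ^ k / fact k)"
    by (simp only: poly_kernel_def)
  then show ?thesis
    by simp
qed

text \<open>\<open>\<Lambda>\<close> may be infinite. Summability is required explicitly, because \<open>infsum\<close> of a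
  non-summable family is 0.\<close>
definition sampling_set :: "complex set \<Rightarrow> bool" where
  "sampling_set \<Lambda> \<longleftrightarrow> (\<exists>A>0. \<exists>B>0. \<forall>f\<in>fock_space.
     (\<lambda>l. (cmod (f l))\<^sup>2 * exp (- pi * (cmod l)\<^sup>2)) summable_on \<Lambda> \<and>
     A * (fock_norm f)\<^sup>2 \<le> (\<Sum>\<^sub>\<infinity>l\<in>\<Lambda>. (cmod (f l))\<^sup>2 * exp (- pi * (cmod l)\<^sup>2)) \<and>
     (\<Sum>\<^sub>\<infinity>l\<in>\<Lambda>. (cmod (f l))\<^sup>2 * exp (- pi * (cmod l)\<^sup>2)) \<le> B * (fock_norm f)\<^sup>2)"

definition marcinkiewicz_zygmund :: "(nat \<Rightarrow> complex set) \<Rightarrow> bool" where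
  "marcinkiewicz_zygmund \<Lambda> \<longleftrightarrow> (\<forall>n. finite (\<Lambda> n)) \<and>
     (\<exists>A>0. \<exists>B>0. \<exists>n0. \<forall>n\<ge>n0. \<forall>p\<in>poly_space n.
        A * (fock_norm p)\<^sup>2 \<le> (\<Sum>l\<in>\<Lambda> n. (cmod (p l))\<^sup>2 / Re (poly_kernel n l l)) \<and>
        (\<Sum>l\<in>\<Lambda> n. (cmod (p l))\<^sup>2 / Re (poly_kernel n l l)) \<le> B * (fock_norm p)\<^sup>2)"

text \<open>Intended for nonempty bounded sets, where both suprema are over nonempty sets bounded
  above (so \<open>Sup\<close> on the reals is the least upper bound).\<close>
definition hausdorff_dist :: "'a::metric_space set \<Rightarrow> 'a set \<Rightarrow> real" where
  "hausdorff_dist X Y = max (SUP x\<in>X. infdist x Y) (SUP y\<in>Y. infdist y X)"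

definition weak_limit :: "(nat \<Rightarrow> complex set) \<Rightarrow> complex set \<Rightarrow> bool" where
  "weak_limit \<Lambda> L \<longleftrightarrow> (\<forall>c r. r > 0 \<longrightarrow>
     (\<lambda>n. hausdorff_dist (\<Lambda> n \<inter> cball c r \<union> sphere c r) (L \<inter> cball c r \<union> sphere c r))
       \<longlonglongrightarrow> 0)"

end

theory Submission
  imports Defs "HOL-Complex_Analysis.Complex_Analysis" "HOL-Probability.Distributions"
begin

text \<open>
  Everything rests on Parseval's identity
  \<open>\<parallel>f\<parallel>\<^sup>2 = \<Sum>\<^sub>k |c\<^sub>k|\<^sup>2 k! / \<pi>\<^sup>k\<close> for \<open>f = \<Sum>\<^sub>k c\<^sub>k z\<^sup>k\<close>, obtained by averaging over
  rotations by roots of unity. It gives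
  \<open>\<parallel>z\<^sup>m p\<parallel>\<^sup>2 \<le> ((n + m) / \<pi>)\<^sup>m \<parallel>p\<parallel>\<^sup>2\<close> for \<open>p\<close> of degree at most \<open>n\<close>. Points outside a disk of
  radius \<open>\<rho>\<close> are then controlled by applying the upper inequality to \<open>(z / \<rho>)\<^sup>m p\<close>, which dominates
  \<open>p\<close> there.

  For the first part take \<open>m \<approx> \<surd>n\<close>: the points of \<open>\<Lambda>\<close> outside \<open>B\<^bsub>\<rho>\<^sub>n\<^esub>\<close> contribute at
  most \<open>B e\<^bsup>-(\<tau>-2)/2\<^esup> \<parallel>p\<parallel>\<^sup>2\<close>. Inside the disk \<open>k\<^sub>n(z, z)\<close> is comparable to
  \<open>e\<^bsup>\<pi>|z|\<^sup>2\<^esup>\<close>, by a lower bound for the Poisson distribution function.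

  For the second part, \<open>k\<^sub>n(z, z) \<rightarrow> e\<^bsup>\<pi>|z|\<^sup>2\<^esup>\<close> locally uniformly, so the upper inequality passes to
  finite subsets of the weak limit. In the lower inequality for a fixed polynomial, the
  points outside a disk of radius \<open>R\<close> are controlled with \<open>m = 1\<close>. The points inside converge
  to points of the limit, with multiplicity at most \<open>2 B\<close>. Taylor polynomials extend the
  inequality to all of the Fock space.
\<close>

section \<open>Rotations and Gaussian moments in the complex plane\<close>

text \<open>Boxes determine Lebesgue measure, and for the basis 1, i they are rectangles. This makes
  Tonelli available in real coordinates.\<close>

lemma lborel_complex_eq_distr:
  "(lborel :: complex measure) = distr (lborel \<Otimes>\<^sub>M lborel) borel (\<lambda>(x, y). Complex x y)"
proof (rule lborel_eqI)
  have m [measurable]: "(\<lambda>(x, y). Complex x y) \<in> borel_measurable (lborel \<Otimes>\<^sub>M lborel)"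
    unfolding Complex_eq case_prod_beta by measurable
  fix l u :: complex
  assume le: "\<And>b. b \<in> Basis \<Longrightarrow> l \<bullet> b \<le> u \<bullet> b"
  have le: "Re l \<le> Re u" "Im l \<le> Im u"
    using le[of 1] le[of \<i>] by (simp_all add: Basis_complex_def inner_complex_def)
  have "(\<lambda>(x, y). Complex x y) -` box l u \<inter> space (lborel \<Otimes>\<^sub>M lborel)
      = {Re l<..<Re u} \<times> {Im l<..<Im u}"
    by (auto simp: box_def Basis_complex_def inner_complex_def space_pair_measure)
  then have "emeasure (distr (lborel \<Otimes>\<^sub>M lborel) borel (\<lambda>(x, y). Complex x y)) (box l u)
      = emeasure (lborel \<Otimes>\<^sub>M lborel) ({Re l<..<Re u} \<times> {Im l<..<Im u})"
    by (subst emeasure_distr) auto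
  also have "\<dots> = ennreal ((Re u - Re l) * (Im u - Im l))"
    using le by (subst lborel.emeasure_pair_measure_Times) (auto simp: ennreal_mult)
  finally show "emeasure (distr (lborel \<Otimes>\<^sub>M lborel) borel (\<lambda>(x, y). Complex x y)) (box l u)
      = (\<Prod>b\<in>Basis. (u - l) \<bullet> b)"
    by (simp add: Basis_complex_def inner_complex_def)
qed simp

lemma nn_integral_lborel_complex:
  assumes [measurable]: "F \<in> borel_measurable borel"
  shows "(\<integral>\<^sup>+z. F z \<partial>lborel) = (\<integral>\<^sup>+x. \<integral>\<^sup>+y. F (Complex x y) \<partial>lborel \<partial>lborel)"
    and "(\<integral>\<^sup>+z. F z \<partial>lborel) = (\<integral>\<^sup>+y. \<integral>\<^sup>+x. F (Complex x y) \<partial>lborel \<partial>lborel)"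
proof -
  have [measurable]: "(\<lambda>(x, y). Complex x y) \<in> borel_measurable (lborel \<Otimes>\<^sub>M lborel)"
    unfolding Complex_eq case_prod_beta by measurable
  have *: "(\<integral>\<^sup>+z. F z \<partial>lborel) = (\<integral>\<^sup>+(x, y). F (Complex x y) \<partial>(lborel \<Otimes>\<^sub>M lborel))"
    by (subst lborel_complex_eq_distr, subst nn_integral_distr)
       (simp_all add: split_beta')
  have [measurable]: "(\<lambda>(x, y). F (Complex x y)) \<in> borel_measurable (lborel \<Otimes>\<^sub>M lborel)"
    unfolding Complex_eq case_prod_beta by measurable
  show "(\<integral>\<^sup>+z. F z \<partial>lborel) = (\<integral>\<^sup>+x. \<integral>\<^sup>+y. F (Complex x y) \<partial>lborel \<partial>lborel)"
    unfolding * by (subst lborel.nn_integral_fst[symmetric]) auto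
  show "(\<integral>\<^sup>+z. F z \<partial>lborel) = (\<integral>\<^sup>+y. \<integral>\<^sup>+x. F (Complex x y) \<partial>lborel \<partial>lborel)"
    unfolding * by (subst lborel_pair.nn_integral_snd[symmetric]) auto
qed

text \<open>With the unchanged coordinate held fixed, a shear translates the other one, so Tonelli
  in the matching order leaves only translation invariance on the line.\<close>

lemma nn_integral_shear:
  assumes [measurable]: "F \<in> borel_measurable borel"
  shows nn_integral_shear_Re: "(\<integral>\<^sup>+z. F (z + of_real (t * Im z)) \<partial>lborel) = (\<integral>\<^sup>+z. F z \<partial>lborel)"
    and nn_integral_shear_Im: "(\<integral>\<^sup>+z. F (z + \<i> * of_real (t * Re z)) \<partial>lborel) = (\<integral>\<^sup>+z. F z \<partial>lborel)"
proof -
  have "(\<integral>\<^sup>+z. F (z + of_real (t * Im z)) \<partial>lborel) = 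
      (\<integral>\<^sup>+y. \<integral>\<^sup>+x. F (Complex (t * y + 1 * x) y) \<partial>lborel \<partial>lborel)"
    by (subst nn_integral_lborel_complex(2)) (auto intro!: nn_integral_cong arg_cong[of _ _ F] complex_eqI)
  also have "\<dots> = (\<integral>\<^sup>+y. \<integral>\<^sup>+x. F (Complex x y) \<partial>lborel \<partial>lborel)"
  proof (rule nn_integral_cong)
    fix y
    have "(\<lambda>x. F (Complex x y)) \<in> borel_measurable borel"
      unfolding Complex_eq by measurable
    from nn_integral_real_affine[OF this, of 1 "t * y"]
    show "(\<integral>\<^sup>+x. F (Complex (t * y + 1 * x) y) \<partial>lborel) = (\<integral>\<^sup>+x. F (Complex x y) \<partial>lborel)"
      by simp
  qed
  finally show "(\<integral>\<^sup>+z. F (z + of_real (t * Im z)) \<partial>lborel) = (\<integral>\<^sup>+z. F z \<partial>lborel)"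
    by (simp add: nn_integral_lborel_complex(2))
  have "(\<integral>\<^sup>+z. F (z + \<i> * of_real (t * Re z)) \<partial>lborel) = 
      (\<integral>\<^sup>+x. \<integral>\<^sup>+y. F (Complex x (t * x + 1 * y)) \<partial>lborel \<partial>lborel)"
    by (subst nn_integral_lborel_complex(1)) (auto intro!: nn_integral_cong arg_cong[of _ _ F] complex_eqI)
  also have "\<dots> = (\<integral>\<^sup>+x. \<integral>\<^sup>+y. F (Complex x y) \<partial>lborel \<partial>lborel)"
  proof (rule nn_integral_cong)
    fix x
    have "(\<lambda>y. F (Complex x y)) \<in> borel_measurable borel"
      unfolding Complex_eq by measurable
    from nn_integral_real_affine[OF this, of 1 "t * x"]
    show "(\<integral>\<^sup>+y. F (Complex x (t * x + 1 * y)) \<partial>lborel) = (\<integral>\<^sup>+y. F (Complex x y) \<partial>lborel)"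
      by simp
  qed
  finally show "(\<integral>\<^sup>+z. F (z + \<i> * of_real (t * Re z)) \<partial>lborel) = (\<integral>\<^sup>+z. F z \<partial>lborel)"
    by (simp add: nn_integral_lborel_complex(1))
qed

text \<open>A rotation by an angle other than \<open>\<pi>\<close> is a product of three shears.\<close>
lemma nn_integral_rotation:
  assumes [measurable]: "F \<in> borel_measurable borel"
  assumes "cmod w = 1" "w \<noteq> -1"
  shows "(\<integral>\<^sup>+z. F (w * z) \<partial>lborel) = (\<integral>\<^sup>+z. F z \<partial>lborel)"
proof -
  \<comment> \<open>For \<open>w = cis a\<close> this is \<open>- tan (a / 2)\<close>. Shears with
    parameters \<open>t\<close>, \<open>sin a\<close>, \<open>t\<close> compose to the rotation; the
    tangent is undefined only at \<open>w = -1\<close>.\<close>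
  define t where "t = - Im w / (1 + Re w)"
  have n: "(Re w)\<^sup>2 + (Im w)\<^sup>2 = 1"
    using assms(2) by (simp add: cmod_def)
  have c: "1 + Re w \<noteq> 0"
  proof
    assume "1 + Re w = 0"
    then have "Re w = -1" by simp
    with n have "Im w = 0" by simp
    with \<open>Re w = -1\<close> have "w = -1" by (simp add: complex_eq_iff)
    with assms(3) show False by simp
  qed
  have t: "t * (1 + Re w) = - Im w" using c by (simp add: t_def)
  have ts: "t * Im w = Re w - 1"
  proof -
    have "t * Im w * (1 + Re w) = - (Im w)\<^sup>2"
      using t by (metis mult.assoc mult.commute mult_minus_left power2_eq_square)
    also have "\<dots> = (Re w - 1) * (1 + Re w)"
      using n by (simp add: algebra_simps power2_eq_square)
    finally show ?thesis using c by simp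
  qed
  let ?S = "\<lambda>z. z + of_real (t * Im z)" and ?T = "\<lambda>z. z + \<i> * of_real (Im w * Re z)"
  have [measurable]: "?S \<in> borel_measurable borel" "?T \<in> borel_measurable borel" by measurable
  have "w * z = ?S (?T (?S z))" for z
  proof (rule complex_eqI)
    show im: "Im (w * z) = Im (?S (?T (?S z)))"
      using arg_cong[OF ts, of "\<lambda>u. u * Im z"] by (simp add: algebra_simps)
    have "Re (?S (?T (?S z))) = (1 + t * Im w) * Re z + t * (2 + t * Im w) * Im z"
      by (simp add: algebra_simps)
    also have "\<dots> = Re w * Re z + (t * (1 + Re w)) * Im z"
      unfolding ts by (simp add: algebra_simps)
    also have "\<dots> = Re (w * z)" unfolding t by simp
    finally show "Re (w * z) = Re (?S (?T (?S z)))" by simp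
  qed
  then have "(\<integral>\<^sup>+z. F (w * z) \<partial>lborel) = (\<integral>\<^sup>+z. F (?S (?T (?S z))) \<partial>lborel)" by (simp only:)
  also have "\<dots> = (\<integral>\<^sup>+z. F (?S (?T z)) \<partial>lborel)"
    by (rule nn_integral_shear_Re[where F = "\<lambda>z. F (?S (?T z))"]) measurable
  also have "\<dots> = (\<integral>\<^sup>+z. F (?S z) \<partial>lborel)"
    by (rule nn_integral_shear_Im[where F = "\<lambda>z. F (?S z)"]) measurable
  also have "\<dots> = (\<integral>\<^sup>+z. F z \<partial>lborel)"
    by (rule nn_integral_shear_Re) measurable
  finally show ?thesis .
qed

section \<open>Gaussian moments from the distribution of the squared modulus\<close>

lemma distr_uminus_cmod_square:
  "distr lborel borel (\<lambda>z::complex. - (cmod z)\<^sup>2)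
     = density lborel (\<lambda>s. ennreal pi * indicator {..0} s)" (is "?M = ?N")
proof (rule measure_eqI_lessThan)
  fix x :: real
  \<comment> \<open>The sign makes the half-lines \<open>{x<..}\<close> pull back to disks, which
    have finite area. That area is \<open>pi\<close> times the squared radius, so the density is the
    constant \<open>pi\<close>; this takes the place of polar coordinates.\<close>
  have "(\<lambda>z::complex. - (cmod z)\<^sup>2) -` {x<..} = ball 0 (sqrt (- x))"
  proof (intro set_eqI iffI)
    fix z :: complex assume "z \<in> (\<lambda>z. - (cmod z)\<^sup>2) -` {x<..}"
    then have "(cmod z)\<^sup>2 < - x" by simp
    then show "z \<in> ball 0 (sqrt (- x))" by (simp add: real_less_rsqrt)
  next
    fix z :: complex assume "z \<in> ball 0 (sqrt (- x))"
    then have "cmod z < sqrt (-x)" by simp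
    moreover have "(cmod z)\<^sup>2 < (sqrt (-x))\<^sup>2"
      using calculation by (intro power_strict_mono) auto
    moreover have "0 < sqrt (-x)" using calculation(1) norm_ge_zero[of z] by linarith
    then have "- x > 0" by simp
    ultimately show "z \<in> (\<lambda>z. - (cmod z)\<^sup>2) -` {x<..}" by simp
  qed
  then have M: "emeasure ?M {x<..} = emeasure lborel (ball (0::complex) (sqrt (- x)))"
    by (subst emeasure_distr) auto
  have N: "emeasure ?N {x<..} = ennreal pi * emeasure lborel {x<..0}"
  proof -
    have "emeasure ?N {x<..} = (\<integral>\<^sup>+s. ennreal pi * indicator {..0} s * indicator {x<..} s \<partial>lborel)"
      by (subst emeasure_density) auto
    also have "\<dots> = (\<integral>\<^sup>+s. ennreal pi * indicator {x<..0} s \<partial>lborel)"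
      by (intro nn_integral_cong) (simp split: split_indicator)
    finally show ?thesis by (simp add: nn_integral_cmult_indicator)
  qed
  show "emeasure ?M {x<..} < \<infinity>" 
    unfolding M by (metis emeasure_lborel_ball_finite infinity_ennreal_def)
  show "emeasure ?M {x<..} = emeasure ?N {x<..}"
  proof (cases "x < 0")
    case True
    then show ?thesis unfolding M N
      using ennreal_mult[of pi "- x"] by (subst emeasure_ball) (auto simp: unit_ball_vol_2)
  next
    case False
    then show ?thesis unfolding M N by (auto simp: ball_empty)
  qed
qed auto

lemma nn_integral_fock_weight_power:
  "(\<integral>\<^sup>+z. ennreal ((cmod z) ^ (2 * k) * exp (- pi * (cmod z)\<^sup>2)) \<partial>lborel) = ennreal (fact k / pi ^ k)"
proof -
  let ?g = "\<lambda>s::real. ennreal ((- s) ^ k * exp (pi * s))"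
  have "(\<integral>\<^sup>+z. ennreal ((cmod z) ^ (2 * k) * exp (- pi * (cmod z)\<^sup>2)) \<partial>lborel)
      = (\<integral>\<^sup>+z. ?g (- (cmod z)\<^sup>2) \<partial>lborel)"
    by (simp add: power_mult)
  also have "\<dots> = (\<integral>\<^sup>+s. ?g s \<partial>distr lborel borel (\<lambda>z::complex. - (cmod z)\<^sup>2))"
    by (subst nn_integral_distr) auto
  also have "\<dots> = (\<integral>\<^sup>+s. (ennreal pi * indicator {..0} s) * ?g s \<partial>lborel)"
    unfolding distr_uminus_cmod_square by (subst nn_integral_density) auto
  \<comment> \<open>Substituting \<open>- s / pi\<close> for \<open>s\<close> leads to Euler's
    integral for \<open>fact k\<close>.\<close>
  also have "\<dots> = ennreal (1 / pi) * (\<integral>\<^sup>+s. (ennreal pi * indicator {..0} (0 + (-1/pi) * s)) * ?g (0 + (-1/pi) * s) \<partial>lborel)"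
    by (subst nn_integral_real_affine[where c = "-1/pi" and t = 0]) auto
  also have "\<dots> = (\<integral>\<^sup>+s. ennreal (1 / pi ^ k) * (ennreal (s ^ k * exp (- s)) * indicator {0..} s) \<partial>lborel)"
    by (subst nn_integral_cmult[symmetric])
       (auto intro!: nn_integral_cong simp: ennreal_mult'[symmetric] power_divide zero_le_divide_iff pi_gt_zero[THEN linorder_not_le[THEN iffD2]]
             split: split_indicator)
  also have "\<dots> = ennreal (1 / pi ^ k) * ennreal (fact k)"
    by (subst nn_integral_cmult) (auto simp: nn_intergal_power_times_exp_Ici)
  also have "\<dots> = ennreal (fact k / pi ^ k)"
    by (simp add: ennreal_mult'[symmetric])
  finally show ?thesis .
qed

section \<open>Parseval's identity in the Fock space\<close>

text \<open>The discrete Fourier transform is unitary up to the factor \<open>N\<close>: once the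
  square is expanded, the cross terms carry geometric sums over nontrivial roots of unity, which
  vanish.\<close>

lemma parseval_roots_of_unity:
  fixes a :: "nat \<Rightarrow> complex"
  assumes "N > 0"
  defines "w \<equiv> cis (2 * pi / real N)"
  shows "(\<Sum>j<N. (cmod (\<Sum>k<N. a k * w ^ (j * k)))\<^sup>2) = real N * (\<Sum>k<N. (cmod (a k))\<^sup>2)"
proof -
  have w: "w ^ k = exp (2 * of_real pi * \<i> * of_nat k / of_nat N)" for k
    by (simp add: w_def cis_conv_exp exp_of_nat_mult[symmetric] mult_ac)
  have w0: "w \<noteq> 0" and cw: "cnj w = inverse w"
    by (simp_all add: w_def cis_cnj)
  have inj: "k = l" if "w ^ k = w ^ l" "k < N" "l < N" for k l
  proof -
    have "k mod N = l mod N"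
      using that(1) complex_root_unity_eq[of N k l] assms(1) unfolding w by simp
    then show ?thesis using that(2,3) by simp
  qed
  have orth: "(\<Sum>j<N. (w ^ k / w ^ l) ^ j) = (if k = l then of_nat N else 0)" if "k < N" "l < N" for k l
  proof (cases "k = l")
    case False
    then have "w ^ k / w ^ l \<noteq> 1" using inj[OF _ that] w0 by auto
    moreover have "w ^ N = 1" using assms(1) by (simp add: w)
    then have "(w ^ k / w ^ l) ^ N = 1"
      by (simp add: power_divide power_mult[symmetric] mult.commute[of _ N] power_mult)
    ultimately show ?thesis using False by (simp add: geometric_sum)
  qed (use w0 in auto)
  have "complex_of_real (\<Sum>j<N. (cmod (\<Sum>k<N. a k * w ^ (j * k)))\<^sup>2)
      = (\<Sum>j<N. (\<Sum>k<N. a k * w ^ (j * k)) * cnj (\<Sum>k<N. a k * w ^ (j * k)))"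
    by (simp only: of_real_sum complex_norm_square)
  also have "\<dots> = (\<Sum>j<N. \<Sum>k<N. \<Sum>l<N. a k * cnj (a l) * (w ^ k / w ^ l) ^ j)"
    by (simp add: cw sum_product field_simps power_divide power_mult[symmetric])
  also have "\<dots> = (\<Sum>k<N. \<Sum>l<N. \<Sum>j<N. a k * cnj (a l) * (w ^ k / w ^ l) ^ j)"
    by (subst sum.swap, rule sum.cong[OF refl], rule sum.swap)
  also have "\<dots> = (\<Sum>k<N. \<Sum>l<N. a k * cnj (a l) * (if k = l then of_nat N else 0))"
    by (intro sum.cong refl) (simp add: sum_distrib_left[symmetric] orth del: mult_eq_0_iff)
  also have "\<dots> = (\<Sum>k<N. a k * cnj (a k) * of_nat N)"
    by (intro sum.cong refl) (simp add: if_distrib sum.delta cong: if_cong)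
  also have "\<dots> = complex_of_real (real N * (\<Sum>k<N. (cmod (a k))\<^sup>2))"
    by (simp add: complex_norm_square sum_distrib_left mult_ac del: of_real_power)
  finally show ?thesis by (simp only: of_real_eq_iff)
qed

lemma everywhere_sums_summable_norm:
  fixes c :: "nat \<Rightarrow> complex"
  assumes "\<And>z. (\<lambda>k. c k * z ^ k) sums f z" and "0 \<le> r"
  shows "summable (\<lambda>k. cmod (c k) * r ^ k)"
proof -
  have "summable (\<lambda>k. norm (c k * of_real r ^ k))"
    by (rule powser_insidea[of c "of_real (r + 1)"]) (use assms in \<open>auto simp: sums_iff\<close>)
  then show ?thesis using assms(2) by (simp add: norm_mult norm_power)
qed

lemma everywhere_sums_summable_norm_square:
  fixes c :: "nat \<Rightarrow> complex"
  assumes "\<And>z. (\<lambda>k. c k * z ^ k) sums f z"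
  shows "summable (\<lambda>k. (cmod (c k))\<^sup>2 * (cmod z) ^ (2 * k))"
proof (rule summable_comparison_test_ev)
  have s: "summable (\<lambda>k. cmod (c k) * cmod z ^ k)"
    by (rule everywhere_sums_summable_norm[OF assms]) simp
  then show "summable (\<lambda>k. cmod (c k) * cmod z ^ k)" .
  have "\<forall>\<^sub>F k in sequentially. cmod (c k) * cmod z ^ k < 1"
    using summable_LIMSEQ_zero[OF s] by (rule order_tendstoD) simp
  then show "\<forall>\<^sub>F k in sequentially. norm ((cmod (c k))\<^sup>2 * cmod z ^ (2 * k)) \<le> cmod (c k) * cmod z ^ k"
  proof eventually_elim
    case (elim k)
    then have "(cmod (c k) * cmod z ^ k)\<^sup>2 \<le> cmod (c k) * cmod z ^ k"
      by (auto simp: power2_eq_square intro!: mult_left_le)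
    then show ?case by (simp add: power_mult_distrib power_mult[symmetric] mult.commute[of 2])
  qed
qed

lemma everywhere_sums_continuous:
  fixes c :: "nat \<Rightarrow> complex"
  assumes "\<And>z. (\<lambda>k. c k * z ^ k) sums f z"
  shows "continuous_on UNIV f"
proof -
  have "f = (\<lambda>z. \<Sum>k. c k * z ^ k)" using assms by (auto simp: sums_iff)
  moreover have "isCont (\<lambda>z. \<Sum>k. c k * z ^ k) z" for z
    by (rule isCont_powser[of c "of_real (cmod z + 1)"]) (use assms in \<open>auto simp: sums_iff\<close>)
  ultimately show ?thesis by (simp add: continuous_at_imp_continuous_on)
qed

lemma partial_sum_rotation_average:
  assumes "N > 0"
  shows "(\<Sum>j<N. (cmod (\<Sum>k<N. c k * (cis (2 * pi / real N) ^ j * z) ^ k))\<^sup>2)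
      = real N * (\<Sum>k<N. (cmod (c k))\<^sup>2 * (cmod z) ^ (2 * k))"
  using parseval_roots_of_unity[OF assms, of "\<lambda>k. c k * z ^ k"]
  by (simp add: power_mult_distrib power_mult[symmetric] norm_mult norm_power mult_ac)

text \<open>For \<open>f\<close> itself, exponents that agree modulo \<open>N\<close> interfere. For
  its partial sum of length \<open>N\<close> the average is exact, and the error of this replacement
  is governed by the tail of the absolute series, uniformly on the circle through
  \<open>z\<close>.\<close>

lemma rotation_average_tendsto:
  assumes f: "\<And>z. (\<lambda>k. c k * z ^ k) sums f z"
  shows "(\<lambda>N. (\<Sum>j<N. (cmod (f (cis (2 * pi / real N) ^ j * z)))\<^sup>2) / real N)
     \<longlonglongrightarrow> (\<Sum>k. (cmod (c k))\<^sup>2 * (cmod z) ^ (2 * k))"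
proof -
  define w where "w N = cis (2 * pi / real N)" for N
  define t where "t N = (\<Sum>k. cmod (c (k + N)) * cmod z ^ (k + N))" for N
  define S where "S = (\<Sum>k. cmod (c k) * cmod z ^ k)"
  define p where "p N u = (\<Sum>k<N. c k * u ^ k)" for N u
  have s: "summable (\<lambda>k. cmod (c k) * cmod z ^ k)"
    by (rule everywhere_sums_summable_norm[OF f]) simp
  have [simp]: "cmod (w N) = 1" for N by (simp add: w_def)
  have fp: "cmod (f u - p N u) \<le> t N" if "cmod u = cmod z" for N u
  proof -
    have "(\<lambda>k. c (k + N) * u ^ (k + N)) sums (f u - p N u)"
      using f[of u] unfolding p_def by (subst sums_iff_shift) simp
    moreover have "summable (\<lambda>k. norm (c (k + N) * u ^ (k + N)))"
      using summable_ignore_initial_segment[OF s, of N] by (simp add: norm_mult norm_power that)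
    ultimately show ?thesis
      using summable_norm[of "\<lambda>k. c (k + N) * u ^ (k + N)"] 
      by (simp add: sums_iff t_def norm_mult norm_power that)
  qed
  have fS: "cmod (f u) \<le> S" if "cmod u = cmod z" for u
  proof -
    \<comment> \<open>The empty partial sum turns the tail estimate into a bound for
      \<open>f\<close> on the circle.\<close>
    have "p 0 u = 0" "t 0 = S" by (simp_all add: p_def t_def S_def)
    then show ?thesis using fp[OF that, of 0] by simp
  qed
  have pS: "cmod (p N u) \<le> S" if "cmod u = cmod z" for N u
  proof -
    have "cmod (p N u) \<le> (\<Sum>k<N. cmod (c k) * cmod z ^ k)"
      unfolding p_def by (rule norm_sum[THEN order_trans]) (simp add: norm_mult norm_power that)
    also have "\<dots> \<le> S" unfolding S_def by (rule sum_le_suminf[OF s]) auto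
    finally show ?thesis .
  qed
  have diff: "\<bar>(cmod (f u))\<^sup>2 - (cmod (p N u))\<^sup>2\<bar> \<le> 2 * S * t N" if "cmod u = cmod z" for N u
  proof -
    have "\<bar>(cmod (f u))\<^sup>2 - (cmod (p N u))\<^sup>2\<bar> = (cmod (f u) + cmod (p N u)) * \<bar>cmod (f u) - cmod (p N u)\<bar>"
      by (simp add: power2_eq_square square_diff_square_factored abs_mult)
    also have "\<dots> \<le> (S + S) * t N"
      using fS[OF that] pS[OF that, of N] norm_triangle_ineq3[of "f u" "p N u"] fp[OF that, of N]
      by (intro mult_mono) (auto intro: add_nonneg_nonneg order_trans[OF norm_ge_zero])
    finally show ?thesis by simp
  qed
  define a where "a N = (\<Sum>j<N. (cmod (f (w N ^ j * z)))\<^sup>2) / real N" for N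
  define b where "b N = (\<Sum>k<N. (cmod (c k))\<^sup>2 * (cmod z) ^ (2 * k))" for N
  have ab: "\<bar>a N - b N\<bar> \<le> 2 * S * t N" if "N > 0" for N
  proof -
    have "b N = (\<Sum>j<N. (cmod (p N (w N ^ j * z)))\<^sup>2) / real N"
      using that partial_sum_rotation_average[OF that, of c z] by (simp add: b_def p_def w_def)
    then have "a N - b N = (\<Sum>j<N. (cmod (f (w N ^ j * z)))\<^sup>2 - (cmod (p N (w N ^ j * z)))\<^sup>2) / real N"
      by (simp add: a_def sum_subtractf diff_divide_distrib)
    also have "\<bar>\<dots>\<bar> \<le> (\<Sum>j<N. 2 * S * t N) / real N"
      unfolding abs_divide 
      by (intro divide_mono order_trans[OF sum_abs] sum_mono diff) (auto simp: that norm_mult norm_power)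
    finally show ?thesis using that by simp
  qed
  have "t \<longlonglongrightarrow> 0" unfolding t_def using suminf_exist_split2[OF s] .
  then have "(\<lambda>N. 2 * S * t N) \<longlonglongrightarrow> 0" by (auto intro: tendsto_eq_intros)
  then have "(\<lambda>N. a N - b N) \<longlonglongrightarrow> 0"
    by (rule Lim_null_comparison[rotated]) (auto simp: eventually_at_top_linorder intro!: exI[of _ 1] ab)
  moreover have "b \<longlonglongrightarrow> (\<Sum>k. (cmod (c k))\<^sup>2 * (cmod z) ^ (2 * k))"
    unfolding b_def by (rule summable_LIMSEQ[OF everywhere_sums_summable_norm_square[OF f]])
  ultimately have "a \<longlonglongrightarrow> (\<Sum>k. (cmod (c k))\<^sup>2 * (cmod z) ^ (2 * k))"
    by (rule Lim_transform[rotated])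
  then show ?thesis by (simp add: a_def[abs_def] w_def)
qed

text \<open>For \<open>N \<ge> 3\<close> the basic rotation has an angle strictly between 0 and
  \<open>pi\<close>, so it is not -1, the one rotation outside the shear argument.\<close>

lemma nn_integral_rotation_average:
  assumes [measurable]: "f \<in> borel_measurable borel" and N: "N \<ge> 3"
  shows "(\<integral>\<^sup>+z. ennreal ((\<Sum>j<N. (cmod (f (cis (2 * pi / real N) ^ j * z)))\<^sup>2) / real N * exp (- pi * (cmod z)\<^sup>2)) \<partial>lborel)
      = (\<integral>\<^sup>+z. ennreal ((cmod (f z))\<^sup>2 * exp (- pi * (cmod z)\<^sup>2)) \<partial>lborel)"
proof -
  define w where "w = cis (2 * pi / real N)"
  have [simp]: "cmod w = 1" by (simp add: w_def)
  have w: "w \<noteq> -1"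
  proof
    assume "w = -1"
    then have "sin (2 * pi / real N) = 0" by (simp add: w_def complex_eq_iff)
    moreover have "0 < 2 * pi / real N" "2 * pi / real N < pi"
      using N by (simp_all add: field_simps)
    ultimately show False using sin_gt_zero by fastforce
  qed
  define F where "F z = ennreal ((cmod (f z))\<^sup>2 * exp (- pi * (cmod z)\<^sup>2))" for z
  have [measurable]: "F \<in> borel_measurable borel" unfolding F_def by measurable
  \<comment> \<open>The induction applies one basic rotation at a time, so a power of
    \<open>w\<close> may well equal -1.\<close>
  have rot: "(\<integral>\<^sup>+z. F (w ^ j * z) \<partial>lborel) = (\<integral>\<^sup>+z. F z \<partial>lborel)" for j
  proof (induction j)
    case (Suc j)
    have "(\<integral>\<^sup>+z. F (w ^ Suc j * z) \<partial>lborel) = (\<integral>\<^sup>+z. F (w ^ j * z) \<partial>lborel)"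
      using nn_integral_rotation[of "\<lambda>z. F (w ^ j * z)" w] w by (simp add: mult_ac)
    then show ?case using Suc by simp
  qed simp
  have "ennreal ((\<Sum>j<N. (cmod (f (w ^ j * z)))\<^sup>2) / real N * exp (- pi * (cmod z)\<^sup>2))
      = (\<Sum>j<N. ennreal (1 / real N) * F (w ^ j * z))" for z
    by (simp add: F_def norm_mult norm_power ennreal_mult'[symmetric] sum_distrib_right sum_divide_distrib)
  then have "(\<integral>\<^sup>+z. ennreal ((\<Sum>j<N. (cmod (f (w ^ j * z)))\<^sup>2) / real N * exp (- pi * (cmod z)\<^sup>2)) \<partial>lborel)
      = (\<Sum>j<N. ennreal (1 / real N) * (\<integral>\<^sup>+z. F (w ^ j * z) \<partial>lborel))"
    by (simp add: nn_integral_sum nn_integral_cmult)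
  also have "\<dots> = of_nat N * ennreal (1 / real N) * (\<integral>\<^sup>+z. F z \<partial>lborel)"
    by (simp add: rot mult.assoc)
  also have "of_nat N * ennreal (1 / real N) = 1"
    using N by (simp add: ennreal_of_nat_eq_real_of_nat ennreal_mult'[symmetric])
  finally show ?thesis by (simp add: w_def F_def)
qed

text \<open>Averaging over rotations removes the cross terms and leaves the radial moments.\<close>

lemma nn_integral_fock_partial_sum:
  assumes "N \<ge> 3"
  shows "(\<integral>\<^sup>+z. ennreal ((cmod (\<Sum>k<N. c k * z ^ k))\<^sup>2 * exp (- pi * (cmod z)\<^sup>2)) \<partial>lborel)
      = (\<Sum>k<N. ennreal ((cmod (c k))\<^sup>2 * (fact k / pi ^ k)))"
proof -
  have "(\<integral>\<^sup>+z. ennreal ((cmod (\<Sum>k<N. c k * z ^ k))\<^sup>2 * exp (- pi * (cmod z)\<^sup>2)) \<partial>lborel)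
      = (\<integral>\<^sup>+z. ennreal ((\<Sum>k<N. (cmod (c k))\<^sup>2 * cmod z ^ (2 * k)) * exp (- pi * (cmod z)\<^sup>2)) \<partial>lborel)"
    using assms by (subst nn_integral_rotation_average[symmetric, OF _ assms])
      (auto simp: partial_sum_rotation_average)
  also have "\<dots> = (\<integral>\<^sup>+z. (\<Sum>k<N. ennreal ((cmod (c k))\<^sup>2) * ennreal (cmod z ^ (2 * k) * exp (- pi * (cmod z)\<^sup>2))) \<partial>lborel)"
    by (simp add: ennreal_mult'[symmetric] sum_distrib_right mult.assoc)
  also have "\<dots> = (\<Sum>k<N. ennreal ((cmod (c k))\<^sup>2) * ennreal (fact k / pi ^ k))"
    by (simp add: nn_integral_sum nn_integral_cmult nn_integral_fock_weight_power[simplified])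
  finally show ?thesis by (simp add: ennreal_mult'[symmetric])
qed

text \<open>Fatou's lemma gives both inequalities: applied to the rotation averages of \<open>f\<close> it
  yields Bessel's inequality, applied to the Taylor polynomials of \<open>f\<close> the reverse.\<close>
lemma nn_integral_fock_parseval:
  assumes f: "\<And>z. (\<lambda>k. c k * z ^ k) sums f z"
  shows "(\<integral>\<^sup>+z. ennreal ((cmod (f z))\<^sup>2 * exp (- pi * (cmod z)\<^sup>2)) \<partial>lborel)
      = (\<Sum>k. ennreal ((cmod (c k))\<^sup>2 * (fact k / pi ^ k)))" (is "?I = ?S")
proof (rule antisym)
  have [measurable]: "f \<in> borel_measurable borel"
    using everywhere_sums_continuous[OF f] by (rule borel_measurable_continuous_onI)
  let ?A = "\<lambda>N z. (\<Sum>j<N. (cmod (f (cis (2 * pi / real N) ^ j * z)))\<^sup>2) / real N * exp (- pi * (cmod z)\<^sup>2)"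
  let ?P = "\<lambda>N z. (cmod (\<Sum>k<N. c k * z ^ k))\<^sup>2 * exp (- pi * (cmod z)\<^sup>2)"
  \<comment> \<open>Monotone convergence writes the coefficient sum as the integral of a pointwise
    series, which is the limit of the rotation averages of \<open>f\<close>.\<close>
  have "?S = (\<integral>\<^sup>+z. (\<Sum>k. ennreal ((cmod (c k))\<^sup>2) * ennreal (cmod z ^ (2 * k) * exp (- pi * (cmod z)\<^sup>2))) \<partial>lborel)"
  proof (subst nn_integral_suminf)
    have "ennreal ((cmod (c k))\<^sup>2 * (fact k / pi ^ k))
        = (\<integral>\<^sup>+z. ennreal ((cmod (c k))\<^sup>2) * ennreal (cmod z ^ (2 * k) * exp (- pi * (cmod z)\<^sup>2)) \<partial>lborel)" for k
      by (subst nn_integral_cmult, measurable)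
         (simp only: nn_integral_fock_weight_power ennreal_mult' zero_le_power2)
    then show "?S = (\<Sum>k. \<integral>\<^sup>+z. ennreal ((cmod (c k))\<^sup>2) * ennreal (cmod z ^ (2 * k) * exp (- pi * (cmod z)\<^sup>2)) \<partial>lborel)"
      by (simp only:)
  qed measurable
  also have "\<dots> = (\<integral>\<^sup>+z. liminf (\<lambda>N. ennreal (?A N z)) \<partial>lborel)"
  proof (rule nn_integral_cong)
    fix z :: complex
    have s: "summable (\<lambda>k. (cmod (c k))\<^sup>2 * cmod z ^ (2 * k))"
      by (rule everywhere_sums_summable_norm_square[OF f])
    have "(\<Sum>k. ennreal ((cmod (c k))\<^sup>2) * ennreal (cmod z ^ (2 * k) * exp (- pi * (cmod z)\<^sup>2)))
       = (\<Sum>k. ennreal ((cmod (c k))\<^sup>2 * cmod z ^ (2 * k) * exp (- pi * (cmod z)\<^sup>2)))"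
      by (simp add: ennreal_mult'[symmetric] mult.assoc)
    also have "\<dots> = ennreal ((\<Sum>k. (cmod (c k))\<^sup>2 * cmod z ^ (2 * k)) * exp (- pi * (cmod z)\<^sup>2))"
      using s by (subst suminf_ennreal2) (auto intro: summable_mult2 simp: suminf_mult2[symmetric])
    also have "\<dots> = liminf (\<lambda>N. ennreal (?A N z))"
      by (intro lim_imp_Liminf[symmetric] tendsto_ennrealI tendsto_mult tendsto_const
            rotation_average_tendsto[OF f]) simp
    finally show "(\<Sum>k. ennreal ((cmod (c k))\<^sup>2) * ennreal (cmod z ^ (2 * k) * exp (- pi * (cmod z)\<^sup>2)))
      = liminf (\<lambda>N. ennreal (?A N z))" .
  qed
  also have "\<dots> \<le> liminf (\<lambda>N. \<integral>\<^sup>+z. ennreal (?A N z) \<partial>lborel)"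
    by (rule nn_integral_liminf) measurable
  \<comment> \<open>From \<open>N = 3\<close> on, all averages have the same integral.\<close>
  also have "\<dots> = ?I"
    by (intro lim_imp_Liminf tendsto_eventually eventually_mono[OF eventually_ge_at_top[of 3]]
          nn_integral_rotation_average) auto
  finally show "?S \<le> ?I" .
  have "?I = (\<integral>\<^sup>+z. liminf (\<lambda>N. ennreal (?P N z)) \<partial>lborel)"
    using f unfolding sums_def
    by (intro nn_integral_cong lim_imp_Liminf[symmetric]) 
       (auto intro!: tendsto_ennrealI tendsto_mult tendsto_power tendsto_norm)
  also have "\<dots> \<le> liminf (\<lambda>N. \<integral>\<^sup>+z. ennreal (?P N z) \<partial>lborel)"
    by (rule nn_integral_liminf) measurable
  also have "\<dots> = ?S"
  proof (intro lim_imp_Liminf)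
    have "(\<lambda>N. \<Sum>k<N. ennreal ((cmod (c k))\<^sup>2 * (fact k / pi ^ k))) \<longlonglongrightarrow> ?S"
      by (rule summable_LIMSEQ) simp
    then show "(\<lambda>N. \<integral>\<^sup>+z. ennreal (?P N z) \<partial>lborel) \<longlonglongrightarrow> ?S"
      by (rule Lim_transform_eventually)
         (intro eventually_mono[OF eventually_ge_at_top[of 3]] nn_integral_fock_partial_sum[symmetric])
  qed simp
  finally show "?I \<le> ?S" .
qed

section \<open>Membership and norms through Taylor coefficients\<close>

lemma entire_taylor_sums:
  fixes f :: "complex \<Rightarrow> complex"
  assumes "f holomorphic_on UNIV"
  shows "(\<lambda>k. (deriv ^^ k) f 0 / fact k * z ^ k) sums f z"
  using holomorphic_power_series[of f 0 "cmod z + 1" z] assms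
  by (auto intro: holomorphic_on_subset)

lemma everywhere_sums_holomorphic:
  fixes c :: "nat \<Rightarrow> complex"
  assumes "\<And>z. (\<lambda>k. c k * z ^ k) sums f z"
  shows "f holomorphic_on UNIV"
proof -
  have "f holomorphic_on (\<Union>r. ball 0 r)"
    by (rule holomorphic_on_UN_open) (auto intro!: power_series_holomorphic[of _ _ c] assms)
  moreover have "(\<Union>r. ball (0::complex) r) = UNIV"
    by (auto intro: lt_ex gt_ex)
  ultimately show ?thesis by simp
qed

lemma fock_space_parseval:
  assumes f: "\<And>z. (\<lambda>k. c k * z ^ k) sums f z" and "f \<in> fock_space"
  shows "(\<lambda>k. (cmod (c k))\<^sup>2 * (fact k / pi ^ k)) sums (fock_norm f)\<^sup>2"
proof -
  let ?I = "LINT z|lborel. (cmod (f z))\<^sup>2 * exp (- pi * (cmod z)\<^sup>2)"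
  have "(\<lambda>k. ennreal ((cmod (c k))\<^sup>2 * (fact k / pi ^ k))) sums
      (\<integral>\<^sup>+z. ennreal ((cmod (f z))\<^sup>2 * exp (- pi * (cmod z)\<^sup>2)) \<partial>lborel)"
    unfolding nn_integral_fock_parseval[OF f] by (rule summable_sums) simp
  also have "(\<integral>\<^sup>+z. ennreal ((cmod (f z))\<^sup>2 * exp (- pi * (cmod z)\<^sup>2)) \<partial>lborel) = ennreal ?I"
    using assms(2) by (intro nn_integral_eq_integral) (auto simp: fock_space_def)
  finally have "(\<lambda>k. (cmod (c k))\<^sup>2 * (fact k / pi ^ k)) sums ?I"
    by (subst (asm) sums_ennreal) (auto intro!: integral_nonneg_AE)
  moreover have "(fock_norm f)\<^sup>2 = ?I"
    unfolding fock_norm_def by (rule real_sqrt_pow2) (auto intro!: integral_nonneg_AE)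
  ultimately show ?thesis by simp
qed

text \<open>The converse use of Parseval: a function known through its coefficients, such as a
  Taylor remainder, gets its integrability from the coefficient series.\<close>

lemma fock_spaceI:
  assumes f: "\<And>z. (\<lambda>k. c k * z ^ k) sums f z"
    and "summable (\<lambda>k. (cmod (c k))\<^sup>2 * (fact k / pi ^ k))"
  shows "f \<in> fock_space"
proof -
  have [measurable]: "f \<in> borel_measurable borel"
    using everywhere_sums_continuous[OF f] by (rule borel_measurable_continuous_onI)
  have "(\<integral>\<^sup>+z. ennreal ((cmod (f z))\<^sup>2 * exp (- pi * (cmod z)\<^sup>2)) \<partial>lborel) < \<infinity>"
    unfolding nn_integral_fock_parseval[OF f]
    by (subst suminf_ennreal2[OF _ assms(2)]) auto
  then have "integrable lborel (\<lambda>z. (cmod (f z))\<^sup>2 * exp (- pi * (cmod z)\<^sup>2))"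
    by (intro integrableI_nonneg) auto
  then show ?thesis using everywhere_sums_holomorphic[OF f] by (simp add: fock_space_def)
qed

lemma coeff_sums_poly:
  fixes p :: "complex poly"
  shows "(\<lambda>k. coeff p k * z ^ k) sums poly p z"
  unfolding poly_altdef by (rule sums_finite) (auto simp: coeff_eq_0 not_le)

lemma poly_in_fock_space: "poly p \<in> fock_space"
  by (rule fock_spaceI[OF coeff_sums_poly], rule summable_finite[of "{..degree p}"])
     (auto simp: coeff_eq_0 not_le)

lemma fock_norm_poly:
  assumes "degree p \<le> n"
  shows "(fock_norm (poly p))\<^sup>2 = (\<Sum>k\<le>n. (cmod (coeff p k))\<^sup>2 * (fact k / pi ^ k))"
  by (rule sums_unique2[OF fock_space_parseval[OF coeff_sums_poly poly_in_fock_space]], rule sums_finite)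
     (use assms in \<open>auto simp: coeff_eq_0 not_le\<close>)

text \<open>\<open>fact (k + m) / fact k\<close> is a product of \<open>m\<close> factors, each at
  most \<open>k + m\<close>.\<close>

lemma fact_add_le_power:
  assumes "real (k + m) \<le> b"
  shows "fact (k + m) \<le> fact k * b ^ m"
  using assms
proof (induction m)
  case (Suc m)
  then have "real (k + m + 1) * fact (k + m) \<le> b * (fact k * b ^ m)"
    by (intro mult_mono) auto
  then show ?case by (simp add: algebra_simps)
qed simp

text \<open>The monomial shifts the coefficients by \<open>m\<close>, so each Parseval weight is
  multiplied by \<open>fact (k + m) / (fact k * pi ^ m)\<close>, which is largest at
  \<open>k = n\<close>.\<close>

lemma fock_norm_monom_mult:
  assumes "degree p \<le> n"
  shows "(fock_norm (poly (monom 1 m * p)))\<^sup>2 \<le> (real (n + m) / pi) ^ m * (fock_norm (poly p))\<^sup>2"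
proof -
  have "degree (monom (1::complex) m * p) \<le> n + m"
    using degree_mult_le[of "monom (1::complex) m" p] degree_monom_le[of "1::complex" m] assms by linarith
  then have "(fock_norm (poly (monom 1 m * p)))\<^sup>2
      = (\<Sum>k\<le>n + m. (cmod (coeff (monom 1 m * p) k))\<^sup>2 * (fact k / pi ^ k))"
    by (rule fock_norm_poly)
  also have "\<dots> = (\<Sum>k=0+m..n+m. (cmod (coeff (monom 1 m * p) k))\<^sup>2 * (fact k / pi ^ k))"
    by (rule sum.mono_neutral_right) (auto simp: coeff_monom_mult)
  also have "\<dots> = (\<Sum>k\<le>n. (cmod (coeff p k))\<^sup>2 * (fact (k + m) / pi ^ (k + m)))"
    by (subst sum.shift_bounds_cl_nat_ivl) (simp add: coeff_monom_mult atMost_atLeast0)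
  also have "\<dots> \<le> (\<Sum>k\<le>n. (cmod (coeff p k))\<^sup>2 * (fact k * (real (n + m)) ^ m / pi ^ (k + m)))"
    by (intro sum_mono mult_left_mono divide_right_mono fact_add_le_power) auto
  also have "\<dots> = (real (n + m) / pi) ^ m * (fock_norm (poly p))\<^sup>2"
    unfolding fock_norm_poly[OF assms] sum_distrib_left
    by (intro sum.cong refl) (simp add: power_add power_divide mult_ac)
  finally show ?thesis .
qed

section \<open>The kernel on the diagonal\<close>

lemma Re_poly_kernel_diag: "Re (poly_kernel n z z) = (\<Sum>k\<le>n. (pi * (cmod z)\<^sup>2) ^ k / fact k)"
  unfolding poly_kernel_diag by (rule Re_complex_of_real)

lemma exp_partial_sum_le:
  assumes "0 \<le> (x::real)"
  shows "(\<Sum>k\<le>n. x ^ k / fact k) \<le> exp x"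
proof -
  have "(\<lambda>k. x ^ k / fact k) sums exp x"
    using exp_converges[of x] by (simp add: divide_inverse mult.commute)
  then show ?thesis
    using assms sum_le_suminf[of "\<lambda>k. x ^ k / fact k" "{..n}"] by (simp add: sums_iff)
qed

lemma exp_partial_sum_ge_1:
  assumes "0 \<le> (x::real)"
  shows "1 \<le> (\<Sum>k\<le>n. x ^ k / fact k)"
  using assms member_le_sum[of 0 "{..n}" "\<lambda>k. x ^ k / fact k"] by simp

lemma Re_poly_kernel_diag_ge_1: "1 \<le> Re (poly_kernel n z z)"
  unfolding Re_poly_kernel_diag by (rule exp_partial_sum_ge_1) simp

text \<open>Raising the parameter of a Poisson variable lowers the probability of a value at most
  \<open>n\<close>: the derivative telescopes to
  \<open>- (t ^ n / fact n) * exp (- t)\<close>.\<close>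

lemma exp_partial_sum_antimono:
  assumes "0 \<le> x" "x \<le> (y::real)"
  shows "(\<Sum>k\<le>n. y ^ k / fact k) * exp (- y) \<le> (\<Sum>k\<le>n. x ^ k / fact k) * exp (- x)"
proof (rule DERIV_nonpos_imp_nonincreasing[OF assms(2)])
  fix t assume "x \<le> t"
  have "((\<lambda>t. (\<Sum>k\<le>n. t ^ k / fact k) * exp (- t)) has_real_derivative - (t ^ n / fact n) * exp (- t)) (at t)"
  proof (induction n)
    case 0
    show ?case by (auto intro!: derivative_eq_intros)
  next
    case (Suc n)
    have "((\<lambda>t. t ^ Suc n / fact (Suc n) * exp (- t)) has_real_derivative
        (t ^ n / fact n) * exp (- t) - t ^ Suc n / fact (Suc n) * exp (- t)) (at t)"
      by (rule derivative_eq_intros refl | simp add: field_simps del: of_nat_Suc)+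
    from DERIV_add[OF Suc this] show ?case by (simp add: distrib_right)
  qed
  then show "\<exists>y. ((\<lambda>t. (\<Sum>k\<le>n. t ^ k / fact k) * exp (- t)) has_real_derivative y) (at t) \<and> y \<le> 0"
    using \<open>x \<le> t\<close> assms(1) by (intro exI conjI) auto
qed

section \<open>Lower bounds for Poisson probabilities\<close>

lemma poisson_variance_sums:
  fixes m :: real
  shows "(\<lambda>k. (real k - m)\<^sup>2 * (m ^ k / fact k)) sums (m * exp m)"
proof -
  have e: "(\<lambda>k. m ^ k / fact k) sums exp m"
    using exp_converges[of m] by (simp add: divide_inverse mult.commute)
  \<comment> \<open>A factor \<open>k\<close> cancels against the factorial after an index shift,
    which loses nothing because the term at 0 vanishes. The second moment arises in the same
    way.\<close>
  have "(\<lambda>k. real (Suc k) * (m ^ Suc k / fact (Suc k))) sums (m * exp m)"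
    using sums_mult[OF e, of m] by (simp add: field_simps del: of_nat_Suc)
  then have m1: "(\<lambda>k. real k * (m ^ k / fact k)) sums (m * exp m)"
    by (subst (asm) sums_Suc_iff) simp
  have "(\<lambda>k. (real (Suc k))\<^sup>2 * (m ^ Suc k / fact (Suc k))) sums (m * (m * exp m) + m * exp m)"
  proof -
    have "(real (Suc k))\<^sup>2 * (m ^ Suc k / fact (Suc k)) = m * (real k * (m ^ k / fact k)) + m * (m ^ k / fact k)" for k
      by (simp add: power2_eq_square divide_simps) (simp add: algebra_simps)
    then show ?thesis using sums_add[OF sums_mult[OF m1, of m] sums_mult[OF e, of m]] by simp
  qed
  then have m2: "(\<lambda>k. (real k)\<^sup>2 * (m ^ k / fact k)) sums (m * (m * exp m) + m * exp m)"
    by (subst (asm) sums_Suc_iff) simp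
  have "(\<lambda>k. (real k)\<^sup>2 * (m ^ k / fact k) - 2 * m * (real k * (m ^ k / fact k)) + m\<^sup>2 * (m ^ k / fact k))
      sums (m * (m * exp m) + m * exp m - 2 * m * (m * exp m) + m\<^sup>2 * exp m)"
    by (intro sums_add sums_diff sums_mult m1 m2 e)
  then show ?thesis by (simp add: power2_eq_square algebra_simps)
qed

text \<open>The parabola \<open>1 - (k - m)^2 / a^2\<close> lies below the indicator of the window
  from \<open>m - a\<close> to \<open>n\<close>, because \<open>m + a \<le> n\<close>; the variance
  gives its Poisson mean.\<close>

lemma poisson_chebyshev:
  fixes m a :: real
  assumes "m \<ge> 0" "a > 0" "m + a \<le> real n"
  shows "(1 - m / a\<^sup>2) * exp m \<le> (\<Sum>k | k \<le> n \<and> m - a \<le> real k. m ^ k / fact k)"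
proof (rule sums_le)
  have e: "(\<lambda>k. m ^ k / fact k) sums exp m"
    using exp_converges[of m] by (simp add: divide_inverse mult.commute)
  have "(\<lambda>k. m ^ k / fact k - (1 / a\<^sup>2) * ((real k - m)\<^sup>2 * (m ^ k / fact k))) sums (exp m - (1 / a\<^sup>2) * (m * exp m))"
    by (intro sums_diff sums_mult e poisson_variance_sums)
  then show "(\<lambda>k. (1 - (real k - m)\<^sup>2 / a\<^sup>2) * (m ^ k / fact k)) sums ((1 - m / a\<^sup>2) * exp m)"
    by (simp add: algebra_simps)
  show "(\<lambda>k. if k \<le> n \<and> m - a \<le> real k then m ^ k / fact k else 0) sums
      (\<Sum>k | k \<le> n \<and> m - a \<le> real k. m ^ k / fact k)"
    using sums_If_finite[of "\<lambda>k. k \<le> n \<and> m - a \<le> real k" "\<lambda>k. m ^ k / fact k"] by simp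
  fix k
  show "(1 - (real k - m)\<^sup>2 / a\<^sup>2) * (m ^ k / fact k) \<le> (if k \<le> n \<and> m - a \<le> real k then m ^ k / fact k else 0)"
  proof (cases "k \<le> n \<and> m - a \<le> real k")
    case True
    then show ?thesis using assms mult_right_mono[of "1 - (real k - m)\<^sup>2 / a\<^sup>2" 1 "m ^ k / fact k"] by simp
  next
    case False
    then have "a \<le> \<bar>real k - m\<bar>" using assms(3) by auto
    then have "a\<^sup>2 \<le> (real k - m)\<^sup>2" using assms(2) by (metis abs_le_square_iff abs_of_pos)
    then have "1 - (real k - m)\<^sup>2 / a\<^sup>2 \<le> 0" using assms(2) by simp
    then have "(1 - (real k - m)\<^sup>2 / a\<^sup>2) * (m ^ k / fact k) \<le> 0"
      using assms(1) by (intro mult_nonpos_nonneg) auto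
    then show ?thesis using False by auto
  qed
qed

text \<open>A Poisson variable of parameter \<open>n + \<tau> \<surd>n\<close> is at most \<open>n\<close> with probability bounded
  below: Chebyshev's inequality at the parameter \<open>n - 2 \<surd>n\<close>, followed by a change of
  parameter, which costs a bounded factor.\<close>
lemma exp_partial_sum_ge:
  fixes \<tau> x :: real
  assumes "\<tau> \<ge> 0" "n \<ge> 5" "0 \<le> x" "x \<le> real n + sqrt (real n) * \<tau>"
  shows "3 / 4 * exp (- ((\<tau> + 2) * (\<tau> + 4))) * exp x \<le> (\<Sum>k\<le>n. x ^ k / fact k)"
proof -
  define s where "s = sqrt (real n)"
  define y where "y = real n + s * \<tau>"
  \<comment> \<open>With deviation \<open>2 * s\<close> the window ends no later than
    \<open>n\<close>, and \<open>m / (2 * s)^2 \<le> 1 / 4\<close> yields the factor 3/4. Positivity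
    of \<open>m = s * (s - 2)\<close> is where \<open>n \<ge> 5\<close> enters.\<close>
  define m where "m = real n - 2 * s"
  have s2: "s * s = real n" by (simp add: s_def)
  have "sqrt 4 < s" using assms(2) unfolding s_def by (intro real_sqrt_less_mono) simp
  then have s: "2 < s" by simp
  then have "2 * s < s * s" by simp
  then have m: "0 < m" unfolding m_def s2 by simp
  have y: "real n \<le> y" using s assms(1) by (simp add: y_def)
  then have my: "m \<le> y" using s by (simp add: m_def)
  have y0: "y > 0" using m my by simp
  let ?K = "{k. k \<le> n \<and> m - 2 * s \<le> real k}"
  have fin: "finite ?K" by simp
  have "m / (2 * s)\<^sup>2 \<le> 1 / 4"
    using s s2 by (simp add: m_def power2_eq_square divide_simps algebra_simps)
  then have "3 / 4 * exp m \<le> (1 - m / (2 * s)\<^sup>2) * exp m" by simp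
  also have "\<dots> \<le> (\<Sum>k\<in>?K. m ^ k / fact k)"
    by (rule poisson_chebyshev) (use m s in \<open>auto simp: m_def\<close>)
  finally have cheb: "3 / 4 * exp m \<le> (\<Sum>k\<in>?K. m ^ k / fact k)" .
  \<comment> \<open>The ratio \<open>(y / m) ^ k\<close> of the powers is bounded below through
    \<open>ln (y / m) \<ge> 1 - m / y\<close> and the left end of the window.\<close>
  have tilt: "exp ((m - 2 * s) * (1 - m / y)) * m ^ k \<le> y ^ k" if "k \<in> ?K" for k
  proof -
    have "1 - m / y \<le> ln (y / m)"
      using ln_le_minus_one[of "m / y"] m y0 by (simp add: ln_div)
    moreover have "0 \<le> 1 - m / y" using my y0 by simp
    moreover have "m - 2 * s \<le> real k" using that by simp
    ultimately have "(m - 2 * s) * (1 - m / y) \<le> real k * (1 - m / y)"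
        "real k * (1 - m / y) \<le> real k * ln (y / m)"
      by (simp_all only: mult_right_mono mult_left_mono of_nat_0_le_iff)
    then have "(m - 2 * s) * (1 - m / y) \<le> real k * ln (y / m)" by (rule order_trans)
    then have "exp ((m - 2 * s) * (1 - m / y)) \<le> (y / m) ^ k"
      using m y0 by (metis divide_pos_pos exp_le_cancel_iff exp_ln exp_of_nat_mult mult.commute)
    then show ?thesis using m by (simp add: power_divide field_simps)
  qed
  \<comment> \<open>Here \<open>y - m = s * (\<tau> + 2)\<close>, so the total exponent is
    \<open>- n * (\<tau> + 2) * (\<tau> + 4) / y\<close>, and \<open>n \<le> y\<close>.\<close>
  have "exp (- ((\<tau> + 2) * (\<tau> + 4))) \<le> exp ((m - 2 * s) * (1 - m / y) + m - y)"
  proof -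
    have "(m - 2 * s) * (1 - m / y) + m - y = - ((y - m) * (y - m + 2 * s) / y)"
      using y0 by (simp add: field_simps)
    moreover have "(y - m) * (y - m + 2 * s) = real n * ((\<tau> + 2) * (\<tau> + 4))"
      unfolding y_def m_def s2[symmetric] by (simp add: algebra_simps)
    moreover have "real n * ((\<tau> + 2) * (\<tau> + 4)) \<le> y * ((\<tau> + 2) * (\<tau> + 4))"
      using y assms(1) by (intro mult_right_mono) auto
    then have "real n * ((\<tau> + 2) * (\<tau> + 4)) / y \<le> (\<tau> + 2) * (\<tau> + 4)"
      using y0 by (simp only: pos_divide_le_eq mult.commute)
    ultimately have "- ((\<tau> + 2) * (\<tau> + 4)) \<le> (m - 2 * s) * (1 - m / y) + m - y"
      by (simp only: neg_le_iff_le)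
    then show ?thesis by (simp only: exp_le_cancel_iff)
  qed
  also have "exp ((m - 2 * s) * (1 - m / y) + m - y) = exp ((m - 2 * s) * (1 - m / y)) * exp m * exp (- y)"
    by (simp only: exp_add[symmetric]) simp
  finally have "3 / 4 * exp (- ((\<tau> + 2) * (\<tau> + 4))) \<le> exp ((m - 2 * s) * (1 - m / y)) * (3 / 4 * exp m) * exp (- y)"
    by simp
  also have "\<dots> \<le> exp ((m - 2 * s) * (1 - m / y)) * (\<Sum>k\<in>?K. m ^ k / fact k) * exp (- y)"
    using cheb by simp
  also have "\<dots> \<le> (\<Sum>k\<in>?K. y ^ k / fact k) * exp (- y)"
    unfolding sum_distrib_left
    by (intro mult_right_mono sum_mono) (use tilt in \<open>auto intro: divide_right_mono\<close>)
  also have "\<dots> \<le> (\<Sum>k\<le>n. y ^ k / fact k) * exp (- y)"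
    using y0 by (intro mult_right_mono sum_mono2) auto
  also have "\<dots> \<le> (\<Sum>k\<le>n. x ^ k / fact k) * exp (- x)"
    using assms(3,4) by (intro exp_partial_sum_antimono) (auto simp: y_def s_def)
  finally show ?thesis by (simp add: exp_minus field_simps)
qed

section \<open>Restricting a sampling set to disks\<close>

text \<open>Every point of the disk contributes at least \<open>exp (- pi * r^2)\<close> to a
  convergent sum.\<close>

lemma finite_inter_cball_if_summable_gaussian:
  assumes "(\<lambda>l. exp (- pi * (cmod l)\<^sup>2)) summable_on \<Lambda>"
  shows "finite (\<Lambda> \<inter> cball 0 r)"
proof -
  let ?S = "\<Sum>\<^sub>\<infinity>l\<in>\<Lambda>. exp (- pi * (cmod l)\<^sup>2)"
  have "card G \<le> nat \<lceil>?S * exp (pi * r\<^sup>2)\<rceil>" if "G \<subseteq> \<Lambda> \<inter> cball 0 r" "finite G" for G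
  proof -
    have "real (card G) * exp (- pi * r\<^sup>2) = (\<Sum>l\<in>G. exp (- pi * r\<^sup>2))" by simp
    also have "\<dots> \<le> (\<Sum>l\<in>G. exp (- pi * (cmod l)\<^sup>2))"
      using that by (intro sum_mono) (auto intro!: power_mono)
    also have "\<dots> \<le> ?S"
      using that by (intro finite_sum_le_infsum assms) auto
    finally have "real (card G) \<le> ?S * exp (pi * r\<^sup>2)"
      by (simp add: exp_minus field_simps)
    then show ?thesis by linarith
  qed
  then show ?thesis using finite_if_finite_subsets_card_bdd by blast
qed

lemma norm_poly_le_monom_mult:
  assumes "0 < r" "r \<le> cmod z"
  shows "(cmod (poly p z))\<^sup>2 \<le> (cmod (poly (monom 1 m * p) z))\<^sup>2 / r ^ (2 * m)"
proof -
  have "r ^ (2 * m) * (cmod (poly p z))\<^sup>2 \<le> cmod z ^ (2 * m) * (cmod (poly p z))\<^sup>2"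
    using assms by (intro mult_right_mono power_mono) auto
  also have "\<dots> = (cmod (poly (monom 1 m * p) z))\<^sup>2"
    by (simp add: poly_monom norm_mult norm_power power_mult_distrib power_mult[symmetric] mult.commute)
  finally show ?thesis using assms(1) by (simp add: field_simps)
qed

text \<open>The points of \<open>\<Lambda>\<close> outside the disk of radius \<open>\<rho>\<close> are controlled by comparing \<open>p\<close>
  with \<open>(z / \<rho>)\<^sup>m p\<close>, which is larger there, while its norm is small when \<open>m \<approx> \<surd>n\<close>.\<close>
lemma sampling_sum_outside_disk_le:
  assumes upper: "\<And>f. f \<in> fock_space \<Longrightarrow> (\<lambda>l. (cmod (f l))\<^sup>2 * exp (- pi * (cmod l)\<^sup>2)) summable_on \<Lambda>
      \<and> (\<Sum>\<^sub>\<infinity>l\<in>\<Lambda>. (cmod (f l))\<^sup>2 * exp (- pi * (cmod l)\<^sup>2)) \<le> B * (fock_norm f)\<^sup>2"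
    and "B > 0" "\<tau> \<ge> 2" "n \<ge> 1" "\<tau>\<^sup>2 \<le> real n"
    and "\<rho> > 0" "pi * \<rho>\<^sup>2 = real n + sqrt (real n) * \<tau>" "degree p \<le> n"
  shows "(\<Sum>\<^sub>\<infinity>l\<in>\<Lambda> - cball 0 \<rho>. (cmod (poly p l))\<^sup>2 * exp (- pi * (cmod l)\<^sup>2))
      \<le> B * exp (- (\<tau> - 2) / 2) * (fock_norm (poly p))\<^sup>2"
proof -
  define s where "s = sqrt (real n)"
  \<comment> \<open>Each of the \<open>m\<close> factors gains an amount of order
    \<open>(\<tau> - 2) / s\<close>, so about \<open>s\<close> of them are needed for a fixed total
    gain, while \<open>m\<close> must stay below \<open>s * \<tau>\<close> for any gain at
    all.\<close>
  define m where "m = nat \<lceil>s\<rceil>"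
  define x where "x = real n + s * \<tau>"
  define q where "q = monom 1 m * p"
  let ?w = "\<lambda>f l. (cmod (f l))\<^sup>2 * exp (- pi * (cmod l)\<^sup>2)"
  have x: "pi * \<rho>\<^sup>2 = x" using assms(7) by (simp add: x_def s_def)
  have s1: "1 \<le> s" using assms(4) by (simp add: s_def)
  have s2: "s * s = real n" by (simp add: s_def)
  have m: "s \<le> real m" "real m \<le> 2 * s" using s1 by (auto simp: m_def) linarith
  \<comment> \<open>The condition \<open>\<tau>^2 \<le> n\<close> keeps \<open>x\<close> below
    \<open>2 * n\<close>; this is the source of the 1/2 in the exponent.\<close>
  have "\<tau> \<le> s" using assms(5) by (simp add: s_def real_le_rsqrt)
  then have x2: "x \<le> 2 * real n" using s1 by (simp add: x_def flip: s2)
  have x0: "x > 0" using assms(3,4) s1 by (simp add: x_def add_pos_nonneg)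
  have "real (n + m) / x \<le> 1 - (\<tau> - 2) * s / x"
  proof -
    have "real (n + m) \<le> x - (\<tau> - 2) * s" using m by (simp add: x_def algebra_simps)
    then have "real (n + m) / x \<le> (x - (\<tau> - 2) * s) / x" using x0 by (intro divide_right_mono) auto
    then show ?thesis using x0 by (simp add: diff_divide_distrib)
  qed
  also have "\<dots> \<le> exp (- ((\<tau> - 2) * s / x))"
    using exp_ge_add_one_self[of "- ((\<tau> - 2) * s / x)"] by simp
  finally have "(real (n + m) / x) ^ m \<le> exp (- ((\<tau> - 2) * s / x)) ^ m"
    using x0 by (intro power_mono) auto
  also have "\<dots> = exp (- ((\<tau> - 2) * (real m * s / x)))"
    by (simp add: exp_of_nat_mult[symmetric] mult_ac)
  also have "\<dots> \<le> exp (- (\<tau> - 2) / 2)"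
  proof -
    have "x / 2 \<le> s * s" using x2 s2 by simp
    also have "\<dots> \<le> real m * s" using m s1 by simp
    finally have "1 / 2 \<le> real m * s / x" using x0 by (simp add: field_simps)
    then have "(\<tau> - 2) * (1 / 2) \<le> (\<tau> - 2) * (real m * s / x)"
      using assms(3) by (intro mult_left_mono) auto
    then show ?thesis by simp
  qed
  finally have small: "(real (n + m) / x) ^ m \<le> exp (- (\<tau> - 2) / 2)" .
  note sp = upper[OF poly_in_fock_space[of p]] and sq = upper[OF poly_in_fock_space[of q]]
  have "(\<Sum>\<^sub>\<infinity>l\<in>\<Lambda> - cball 0 \<rho>. ?w (poly p) l) \<le> (\<Sum>\<^sub>\<infinity>l\<in>\<Lambda>. ?w (poly q) l / \<rho> ^ (2 * m))"
  proof (rule infsum_mono_neutral)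
    show "(\<lambda>l. ?w (poly p) l) summable_on \<Lambda> - cball 0 \<rho>"
      using sp by (auto intro: summable_on_subset_banach)
    show "(\<lambda>l. ?w (poly q) l / \<rho> ^ (2 * m)) summable_on \<Lambda>"
      using sq unfolding divide_inverse by (intro summable_on_cmult_left) auto
    fix l assume "l \<in> (\<Lambda> - cball 0 \<rho>) \<inter> \<Lambda>"
    then have "(cmod (poly p l))\<^sup>2 \<le> (cmod (poly q l))\<^sup>2 / \<rho> ^ (2 * m)"
      unfolding q_def using assms(6) by (intro norm_poly_le_monom_mult) auto
    from mult_right_mono[OF this, of "exp (- pi * (cmod l)\<^sup>2)"]
    show "?w (poly p) l \<le> ?w (poly q) l / \<rho> ^ (2 * m)" by simp
  qed (use assms(6) in auto)
  also have "\<dots> = (\<Sum>\<^sub>\<infinity>l\<in>\<Lambda>. ?w (poly q) l) / \<rho> ^ (2 * m)"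
    by (simp add: divide_inverse infsum_cmult_left')
  also have "\<dots> \<le> B * (fock_norm (poly q))\<^sup>2 / \<rho> ^ (2 * m)"
    using sq assms(6) by (intro divide_right_mono) auto
  also have "\<dots> \<le> B * ((real (n + m) / pi) ^ m * (fock_norm (poly p))\<^sup>2) / \<rho> ^ (2 * m)"
    unfolding q_def using assms(2,6,8)
    by (intro divide_right_mono mult_left_mono fock_norm_monom_mult) auto
  also have "\<dots> = B * (real (n + m) / x) ^ m * (fock_norm (poly p))\<^sup>2"
    by (simp add: x[symmetric] power_divide power_mult_distrib power_mult[symmetric])
  also have "\<dots> \<le> B * exp (- (\<tau> - 2) / 2) * (fock_norm (poly p))\<^sup>2"
    using small assms(2) by (intro mult_right_mono mult_left_mono) auto
  finally show ?thesis .
qed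

text \<open>The disks are so large that the part cut off costs at most half of the lower constant,
  and so small that the kernel and the Gaussian weight are comparable on them.\<close>

lemma sampling_set_inter_disks_marcinkiewicz_zygmund:
  assumes "sampling_set \<Lambda>"
  shows "\<exists>\<tau>0>0. \<forall>\<tau>\<ge>\<tau>0. \<forall>\<rho>::nat \<Rightarrow> real.
    (\<forall>n\<ge>1. \<rho> n > 0 \<and> pi * (\<rho> n)\<^sup>2 = real n + sqrt (real n) * \<tau>) \<longrightarrow>
    marcinkiewicz_zygmund (\<lambda>n. \<Lambda> \<inter> cball 0 (\<rho> n))"
proof -
  let ?w = "\<lambda>f l. (cmod (f l))\<^sup>2 * exp (- pi * (cmod l)\<^sup>2)"
  obtain A B where AB: "A > 0" "B > 0" and *: "\<And>f. f \<in> fock_space \<Longrightarrow> ?w f summable_on \<Lambda> \<and>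
     A * (fock_norm f)\<^sup>2 \<le> (\<Sum>\<^sub>\<infinity>l\<in>\<Lambda>. ?w f l) \<and> (\<Sum>\<^sub>\<infinity>l\<in>\<Lambda>. ?w f l) \<le> B * (fock_norm f)\<^sup>2"
    using assms unfolding sampling_set_def by blast
  \<comment> \<open>The constant polynomial 1 makes the Gaussian weights summable. Arbitrary radii
    are treated because \<open>\<rho> 0\<close> is unconstrained.\<close>
  have fin: "finite (\<Lambda> \<inter> cball 0 r)" for r
    using *[OF poly_in_fock_space[of 1]] by (intro finite_inter_cball_if_summable_gaussian) simp
  \<comment> \<open>Chosen so that the points outside the disk contribute at most
    \<open>A / 2\<close> times the squared norm; the 2 meets the condition of that estimate.\<close>
  define \<tau>0 where "\<tau>0 = max 2 (2 + 2 * ln (2 * B / A))"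
  show ?thesis
  proof (intro exI[of _ \<tau>0] conjI allI impI)
    show "\<tau>0 > 0" by (simp add: \<tau>0_def)
    fix \<tau> :: real and \<rho> :: "nat \<Rightarrow> real"
    assume \<tau>: "\<tau>0 \<le> \<tau>" and \<rho>: "\<forall>n\<ge>1. \<rho> n > 0 \<and> pi * (\<rho> n)\<^sup>2 = real n + sqrt (real n) * \<tau>"
    have \<tau>2: "2 \<le> \<tau>" using \<tau> by (simp add: \<tau>0_def)
    have "ln (2 * B / A) \<le> (\<tau> - 2) / 2" using \<tau> by (simp add: \<tau>0_def)
    then have "2 * B / A \<le> exp ((\<tau> - 2) / 2)"
      using AB exp_le_cancel_iff[of "ln (2 * B / A)" "(\<tau> - 2) / 2"] by simp
    then have "B / exp ((\<tau> - 2) / 2) \<le> A / 2" using AB by (simp add: field_simps)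
    then have small: "B * exp (- (\<tau> - 2) / 2) \<le> A / 2"
      unfolding minus_divide_left[symmetric] exp_minus by (simp only: divide_inverse)
    define c where "c = 3 / 4 * exp (- ((\<tau> + 2) * (\<tau> + 4)))"
    have c: "c > 0" by (simp add: c_def)
    \<comment> \<open>The 5 serves the Poisson bound, \<open>\<tau>^2\<close> the estimate outside
      the disk.\<close>
    define n0 where "n0 = max 5 (nat \<lceil>\<tau>\<^sup>2\<rceil>)"
    have "\<forall>n\<ge>n0. \<forall>f\<in>poly_space n.
        A / 2 * (fock_norm f)\<^sup>2 \<le> (\<Sum>l\<in>\<Lambda> \<inter> cball 0 (\<rho> n). (cmod (f l))\<^sup>2 / Re (poly_kernel n l l)) \<and>
        (\<Sum>l\<in>\<Lambda> \<inter> cball 0 (\<rho> n). (cmod (f l))\<^sup>2 / Re (poly_kernel n l l)) \<le> B / c * (fock_norm f)\<^sup>2"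
    proof (intro conjI allI impI ballI)
      fix n f assume n: "n0 \<le> n" and "f \<in> poly_space n"
      then obtain p where p: "f = poly p" "degree p \<le> n" by (auto simp: poly_space_def)
      have n5: "n \<ge> 5" "\<tau>\<^sup>2 \<le> real n" using n unfolding n0_def by linarith+
      then have \<rho>n: "\<rho> n > 0" "pi * (\<rho> n)\<^sup>2 = real n + sqrt (real n) * \<tau>" using \<rho> by auto
      let ?D = "\<Lambda> \<inter> cball 0 (\<rho> n)"
      note f = *[OF poly_in_fock_space[of p], folded p(1)]
      have "(\<Sum>\<^sub>\<infinity>l\<in>\<Lambda>. ?w f l) = (\<Sum>l\<in>?D. ?w f l) + (\<Sum>\<^sub>\<infinity>l\<in>\<Lambda> - cball 0 (\<rho> n). ?w f l)"
      proof -
        have "\<Lambda> = ?D \<union> (\<Lambda> - cball 0 (\<rho> n))" by auto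
        then have "(\<Sum>\<^sub>\<infinity>l\<in>\<Lambda>. ?w f l) = (\<Sum>\<^sub>\<infinity>l\<in>?D \<union> (\<Lambda> - cball 0 (\<rho> n)). ?w f l)" by simp
        also have "\<dots> = (\<Sum>\<^sub>\<infinity>l\<in>?D. ?w f l) + (\<Sum>\<^sub>\<infinity>l\<in>\<Lambda> - cball 0 (\<rho> n). ?w f l)"
          using f by (intro infsum_Un_disjoint) (auto intro: summable_on_subset_banach)
        finally show ?thesis using fin by simp
      qed
      moreover have "(\<Sum>\<^sub>\<infinity>l\<in>\<Lambda> - cball 0 (\<rho> n). ?w f l) \<le> A / 2 * (fock_norm f)\<^sup>2"
      proof -
        have "(\<Sum>\<^sub>\<infinity>l\<in>\<Lambda> - cball 0 (\<rho> n). ?w f l) \<le> B * exp (- (\<tau> - 2) / 2) * (fock_norm f)\<^sup>2"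
          unfolding p(1) by (rule sampling_sum_outside_disk_le[where n = n])
            (use * AB(2) \<tau>2 n5 \<rho>n p(2) in auto)
        also have "\<dots> \<le> A / 2 * (fock_norm f)\<^sup>2" using small by (intro mult_right_mono) auto
        finally show ?thesis .
      qed
      ultimately have "A / 2 * (fock_norm f)\<^sup>2 \<le> (\<Sum>l\<in>?D. ?w f l)" using f by (simp add: field_simps)
      \<comment> \<open>The diagonal kernel is a partial sum of the exponential series, so dividing
        by it can only increase the terms.\<close>
      also have "\<dots> \<le> (\<Sum>l\<in>?D. (cmod (f l))\<^sup>2 / Re (poly_kernel n l l))"
      proof (rule sum_mono)
        fix l
        have k: "Re (poly_kernel n l l) \<le> exp (pi * (cmod l)\<^sup>2)" "1 \<le> Re (poly_kernel n l l)"
          unfolding Re_poly_kernel_diag by (intro exp_partial_sum_le exp_partial_sum_ge_1; simp)+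
        have "?w f l = (cmod (f l))\<^sup>2 / exp (pi * (cmod l)\<^sup>2)" by (simp add: exp_minus divide_inverse)
        also have "\<dots> \<le> (cmod (f l))\<^sup>2 / Re (poly_kernel n l l)" 
          using k by (intro divide_left_mono) auto
        finally show "?w f l \<le> (cmod (f l))\<^sup>2 / Re (poly_kernel n l l)" .
      qed
      finally show "A / 2 * (fock_norm f)\<^sup>2 \<le> (\<Sum>l\<in>?D. (cmod (f l))\<^sup>2 / Re (poly_kernel n l l))" .
      have "(\<Sum>l\<in>?D. (cmod (f l))\<^sup>2 / Re (poly_kernel n l l)) \<le> (\<Sum>l\<in>?D. ?w f l / c)"
      proof (rule sum_mono)
        fix l assume "l \<in> ?D"
        then have "pi * (cmod l)\<^sup>2 \<le> pi * (\<rho> n)\<^sup>2" by (auto intro!: power_mono)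
        then have k: "c * exp (pi * (cmod l)\<^sup>2) \<le> Re (poly_kernel n l l)"
          unfolding Re_poly_kernel_diag c_def using \<tau>2 n5 \<rho>n(2) by (intro exp_partial_sum_ge) auto
        have "(cmod (f l))\<^sup>2 / Re (poly_kernel n l l) \<le> (cmod (f l))\<^sup>2 / (c * exp (pi * (cmod l)\<^sup>2))"
          using k c by (intro divide_left_mono) (auto intro!: mult_pos_pos intro: less_le_trans[rotated])
        also have "\<dots> = ?w f l / c" by (simp add: exp_minus divide_inverse)
        finally show "(cmod (f l))\<^sup>2 / Re (poly_kernel n l l) \<le> ?w f l / c" .
      qed
      also have "\<dots> \<le> B * (fock_norm f)\<^sup>2 / c"
        unfolding sum_divide_distrib[symmetric]
        using f c fin by (intro divide_right_mono order_trans[OF finite_sum_le_infsum]) auto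
      finally show "(\<Sum>l\<in>?D. (cmod (f l))\<^sup>2 / Re (poly_kernel n l l)) \<le> B / c * (fock_norm f)\<^sup>2"
        by simp
    qed
    moreover have "A / 2 > 0" "B / c > 0" using AB c by simp_all
    ultimately show "marcinkiewicz_zygmund (\<lambda>n. \<Lambda> \<inter> cball 0 (\<rho> n))"
      unfolding marcinkiewicz_zygmund_def using fin by blast
  qed
qed

section \<open>Weak limits\<close>

lemma infdist_le_hausdorff_dist:
  assumes "bounded X" "y0 \<in> Y" "x \<in> X"
  shows "infdist x Y \<le> hausdorff_dist X Y"
proof -
  obtain K where K: "\<And>x. x \<in> X \<Longrightarrow> dist y0 x \<le> K"
    using assms(1) bounded_any_center[of X y0] by auto
  have "bdd_above ((\<lambda>x. infdist x Y) ` X)"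
  proof (rule bdd_aboveI2)
    fix x assume "x \<in> X"
    have "infdist x Y \<le> dist y0 x" using infdist_le[OF assms(2), of x] by (simp only: dist_commute)
    then show "infdist x Y \<le> K" using K[OF \<open>x \<in> X\<close>] by linarith
  qed
  then have "infdist x Y \<le> (SUP x\<in>X. infdist x Y)"
    using assms(3) by (rule cSUP_upper2) simp
  then show ?thesis by (simp add: hausdorff_dist_def)
qed

lemma hausdorff_dist_commute: "hausdorff_dist X Y = hausdorff_dist Y X"
  unfolding hausdorff_dist_def by (rule max.commute)

lemma infdist_less_obtains:
  assumes "infdist x Y < e" "Y \<noteq> {}"
  obtains y where "y \<in> Y" "dist x y < e"
proof -
  have "(INF y\<in>Y. dist x y) < e" using assms by (simp add: infdist_notempty)
  then show ?thesis using assms(2) that by (subst (asm) cINF_less_iff) auto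
qed

text \<open>The sphere keeps both sets nonempty and the disk keeps them bounded, so the Hausdorff
  distance really controls distances between points.\<close>

lemma weak_limit_eventually_near:
  fixes c :: complex
  assumes "weak_limit \<Lambda> L" "r > 0" "e > 0"
  defines "X \<equiv> \<lambda>n. \<Lambda> n \<inter> cball c r \<union> sphere c r" and "Y \<equiv> L \<inter> cball c r \<union> sphere c r"
  shows "\<forall>\<^sub>F n in sequentially. (\<forall>x\<in>X n. \<exists>y\<in>Y. dist x y < e) \<and> (\<forall>y\<in>Y. \<exists>x\<in>X n. dist y x < e)"
proof -
  have "c + of_real r \<in> sphere c r" using assms(2) by (simp add: dist_norm)
  then have ne: "c + of_real r \<in> X n" "c + of_real r \<in> Y" for n by (auto simp: X_def Y_def)
  have bd: "bounded (X n)" "bounded Y" for n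
    by (auto simp: X_def Y_def intro: bounded_subset[OF bounded_cball[of c r]])
  have "(\<lambda>n. hausdorff_dist (X n) Y) \<longlonglongrightarrow> 0"
    using assms(1,2) by (auto simp: weak_limit_def X_def Y_def)
  then have "\<forall>\<^sub>F n in sequentially. hausdorff_dist (X n) Y < e"
    using assms(3) by (rule order_tendstoD)
  then show ?thesis
  proof eventually_elim
    case (elim n)
    have "\<exists>y\<in>Y. dist x y < e" if "x \<in> X n" for x
      using infdist_le_hausdorff_dist[OF bd(1) ne(2) that] elim ne(2)
      by (metis empty_iff infdist_less_obtains order_le_less_trans)
    moreover have "\<exists>x\<in>X n. dist y x < e" if "y \<in> Y" for y
      using infdist_le_hausdorff_dist[OF bd(2) ne(1) that, of n] elim ne(1)[of n]
      by (metis empty_iff infdist_less_obtains order_le_less_trans hausdorff_dist_commute)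
    ultimately show ?case by blast
  qed
qed

text \<open>Test polynomials and kernels change with \<open>n\<close>, so the property is required
  jointly in \<open>n\<close> and the point, by means of the product filter.\<close>

lemma weak_limit_eventually_point:
  assumes "weak_limit \<Lambda> L" "w \<in> L" "\<forall>\<^sub>F x in sequentially \<times>\<^sub>F nhds w. P (fst x) (snd x)"
  shows "\<forall>\<^sub>F n in sequentially. \<exists>y\<in>\<Lambda> n. P n y"
proof -
  obtain Q S where Q: "\<forall>\<^sub>F n in sequentially. Q n" "\<forall>\<^sub>F y in nhds w. S y" 
      "\<And>n y. Q n \<Longrightarrow> S y \<Longrightarrow> P n y"
    using assms(3) unfolding eventually_prod_filter by auto
  obtain d where d: "d > 0" "\<And>y. dist y w < d \<Longrightarrow> S y"
    using Q(2) unfolding eventually_nhds_metric by auto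
  \<comment> \<open>In the unit disk about \<open>w\<close>, distance below 1 from the centre
    excludes the sphere, so the nearby point belongs to \<open>\<Lambda> n\<close>.\<close>
  have "min d 1 > 0" using d by simp
  from Q(1) weak_limit_eventually_near[OF assms(1) zero_less_one this, of w] show ?thesis
  proof eventually_elim
    case (elim n)
    have "w \<in> L \<inter> cball w 1 \<union> sphere w 1" using assms(2) by simp
    then obtain y where y: "y \<in> \<Lambda> n \<inter> cball w 1 \<union> sphere w 1" "dist w y < min d 1"
      using elim(2) by blast
    then have "y \<in> \<Lambda> n" "dist y w < d" by (auto simp: dist_commute)
    then show ?case using Q(3) elim(1) d(2) by blast
  qed
qed

text \<open>In the disk of radius \<open>R\<close> a point might be close to the boundary circle
  only. Enlarging the radius by 1 and keeping the tolerance at most 1 forces its partner into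
  \<open>L\<close>; finiteness gives one tolerance for all limit points.\<close>

lemma weak_limit_eventually_cball:
  assumes "weak_limit \<Lambda> L" "finite (L \<inter> cball 0 (R + 1))" "R > 0"
    and "\<And>w. w \<in> L \<Longrightarrow> \<forall>\<^sub>F x in sequentially \<times>\<^sub>F nhds w. P w (fst x) (snd x)"
  shows "\<forall>\<^sub>F n in sequentially. \<forall>y\<in>\<Lambda> n \<inter> cball 0 R. \<exists>w\<in>L \<inter> cball 0 (R + 1). P w n y"
proof -
  let ?F = "L \<inter> cball 0 (R + 1)"
  have "\<forall>w\<in>?F. \<exists>d>0. \<forall>\<^sub>F n in sequentially. \<forall>y. dist y w < d \<longrightarrow> P w n y"
  proof
    fix w assume "w \<in> ?F"
    then obtain Q S where Q: "\<forall>\<^sub>F n in sequentially. Q n" "\<forall>\<^sub>F y in nhds w. S y" 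
        "\<And>n y. Q n \<Longrightarrow> S y \<Longrightarrow> P w n y"
      using assms(4)[of w] unfolding eventually_prod_filter by auto
    obtain d where d: "d > 0" "\<And>y. dist y w < d \<Longrightarrow> S y"
      using Q(2) unfolding eventually_nhds_metric by auto
    have "\<forall>\<^sub>F n in sequentially. \<forall>y. dist y w < d \<longrightarrow> P w n y"
      using Q(1) by eventually_elim (use Q(3) d(2) in blast)
    with d(1) show "\<exists>d>0. \<forall>\<^sub>F n in sequentially. \<forall>y. dist y w < d \<longrightarrow> P w n y" by blast
  qed
  from bchoice[OF this] obtain d where d: "\<And>w. w \<in> ?F \<Longrightarrow> d w > 0"
      "\<And>w. w \<in> ?F \<Longrightarrow> \<forall>\<^sub>F n in sequentially. \<forall>y. dist y w < d w \<longrightarrow> P w n y"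
    by blast
  \<comment> \<open>The inserted 1 caps the tolerance and gives the minimum a value when the disk
    contains no limit point.\<close>
  define e where "e = Min (insert 1 (d ` ?F))"
  have fin: "finite (insert 1 (d ` ?F))" using assms(2) by simp
  have e: "e > 0" "e \<le> 1" "\<And>w. w \<in> ?F \<Longrightarrow> e \<le> d w"
    using fin d(1) by (auto simp: e_def intro: Min_le simp del: Min_insert)
  have "\<forall>\<^sub>F n in sequentially. \<forall>w\<in>?F. \<forall>y. dist y w < d w \<longrightarrow> P w n y"
    by (intro eventually_ball_finite assms(2) ballI d(2))
  moreover have "R + 1 > 0" using assms(3) by simp
  note weak_limit_eventually_near[OF assms(1) this e(1), of 0]
  ultimately show ?thesis
  proof eventually_elim
    case (elim n)
    show ?case
    proof
      fix y assume y: "y \<in> \<Lambda> n \<inter> cball 0 R"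
      then have "y \<in> \<Lambda> n \<inter> cball 0 (R + 1) \<union> sphere 0 (R + 1)" by auto
      then obtain w where w: "w \<in> ?F \<union> sphere 0 (R + 1)" "dist y w < e" using elim(2) by blast
      have "cmod w < R + 1"
        using w(2) e(2) y norm_triangle_ineq2[of w y] by (simp add: dist_norm norm_minus_commute)
      then have "w \<in> ?F" using w(1) by auto
      then show "\<exists>w\<in>?F. P w n y" using elim(1) w(2) e(3) by (meson order_less_le_trans)
    qed
  qed
qed

section \<open>Joint limits in the degree and the point\<close>

lemma power_series_partial_sum_tendsto:
  fixes c :: "nat \<Rightarrow> 'a::{real_normed_field,banach}"
  assumes c: "\<And>z. summable (\<lambda>k. c k * z ^ k)"
    and N: "filterlim N at_top F" and y: "(y \<longlongrightarrow> a) F"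
  shows "((\<lambda>i. \<Sum>k\<le>N i. c k * y i ^ k) \<longlongrightarrow> (\<Sum>k. c k * a ^ k)) F"
proof -
  let ?g = "\<lambda>x. \<Sum>k. c k * x ^ k" and ?P = "\<lambda>n x. \<Sum>k<n. c k * x ^ k"
  \<comment> \<open>Infinite radius gives uniform convergence on a disk around the limit point; with
    continuity of the sum, index and argument may then move together.\<close>
  have "conv_radius c = \<infinity>"
    by (rule conv_radius_inftyI'') (use c in auto)
  then have U: "uniform_limit (cball 0 (norm a + 1)) ?P ?g sequentially"
    using powser_uniform_limit[of "norm a + 1" c 0] by simp
  have "isCont ?g a"
    by (rule isCont_powser[of c "of_real (norm a + 1)"]) (use c in auto)
  then have g: "((\<lambda>i. ?g (y i)) \<longlongrightarrow> ?g a) F"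
    using y by (rule isCont_tendsto_compose)
  have "((\<lambda>i. ?P (Suc (N i)) (y i) - ?g (y i)) \<longlongrightarrow> 0) F"
  proof (rule tendstoI)
    fix e :: real assume "e > 0"
    then have "\<forall>\<^sub>F n in sequentially. \<forall>x\<in>cball 0 (norm a + 1). dist (?P n x) (?g x) < e"
      using U by (simp add: uniform_limit_iff)
    then have "\<forall>\<^sub>F i in F. \<forall>x\<in>cball 0 (norm a + 1). dist (?P (Suc (N i)) x) (?g x) < e"
      using filterlim_compose[OF filterlim_Suc N] by (auto simp: filterlim_iff)
    moreover have "\<forall>\<^sub>F i in F. norm (y i) < norm a + 1"
      using tendsto_norm[OF y] by (rule order_tendstoD) simp
    ultimately show "\<forall>\<^sub>F i in F. dist (?P (Suc (N i)) (y i) - ?g (y i)) 0 < e"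
      by eventually_elim (auto simp: dist_norm)
  qed
  from tendsto_add[OF this g] show ?thesis by (simp add: lessThan_Suc_atMost)
qed

lemma Re_poly_kernel_diag_tendsto:
  "((\<lambda>x. Re (poly_kernel (fst x) (snd x) (snd x))) \<longlongrightarrow> exp (pi * (cmod w)\<^sup>2)) (sequentially \<times>\<^sub>F nhds w)"
proof -
  have e: "(\<lambda>k. t ^ k / fact k) sums exp t" for t :: real
    using exp_converges[of t] by (simp add: divide_inverse mult.commute)
  have e': "summable (\<lambda>k. 1 / fact k * t ^ k)" for t :: real
    using sums_summable[OF e[of t]] by simp
  have "((\<lambda>x. \<Sum>k\<le>fst x. 1 / fact k * (pi * (cmod (snd x))\<^sup>2) ^ k) \<longlongrightarrow> (\<Sum>k. 1 / fact k * (pi * (cmod w)\<^sup>2) ^ k))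
      (sequentially \<times>\<^sub>F nhds w)"
    by (intro power_series_partial_sum_tendsto tendsto_intros filterlim_fst filterlim_snd e')
  then show ?thesis by (simp add: Re_poly_kernel_diag sums_unique[OF e, symmetric])
qed

text \<open>Built from a coefficient sequence, so that the kernel functions arise as well, as
  truncations of an exponential series.\<close>

definition taylor_poly :: "(nat \<Rightarrow> complex) \<Rightarrow> nat \<Rightarrow> complex poly" where
  "taylor_poly c n = (\<Sum>k\<le>n. monom (c k) k)"

lemma coeff_taylor_poly: "coeff (taylor_poly c n) k = (if k \<le> n then c k else 0)"
  by (simp add: taylor_poly_def coeff_sum)

lemma poly_taylor_poly: "poly (taylor_poly c n) z = (\<Sum>k\<le>n. c k * z ^ k)"
  by (simp add: taylor_poly_def poly_sum poly_monom)

lemma degree_taylor_poly: "degree (taylor_poly c n) \<le> n"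
  by (rule degree_le) (simp add: coeff_taylor_poly)

lemma fock_norm_taylor_poly:
  "(fock_norm (poly (taylor_poly c n)))\<^sup>2 = (\<Sum>k\<le>n. (cmod (c k))\<^sup>2 * (fact k / pi ^ k))"
  by (subst fock_norm_poly[OF degree_taylor_poly]) (simp add: coeff_taylor_poly)

lemma taylor_poly_quotient_tendsto:
  assumes f: "\<And>z. (\<lambda>k. c k * z ^ k) sums f z"
  shows "((\<lambda>x. (cmod (poly (taylor_poly c (fst x)) (snd x)))\<^sup>2 / Re (poly_kernel (fst x) (snd x) (snd x)))
     \<longlongrightarrow> (cmod (f w))\<^sup>2 * exp (- pi * (cmod w)\<^sup>2)) (sequentially \<times>\<^sub>F nhds w)"
proof -
  have "((\<lambda>x. \<Sum>k\<le>fst x. c k * snd x ^ k) \<longlongrightarrow> (\<Sum>k. c k * w ^ k)) (sequentially \<times>\<^sub>F nhds w)"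
    by (intro power_series_partial_sum_tendsto filterlim_fst filterlim_snd sums_summable[OF f])
  then have "((\<lambda>x. poly (taylor_poly c (fst x)) (snd x)) \<longlongrightarrow> f w) (sequentially \<times>\<^sub>F nhds w)"
    by (simp add: poly_taylor_poly sums_unique[OF f, symmetric])
  from tendsto_divide[OF tendsto_power[OF tendsto_norm[OF this], of 2] Re_poly_kernel_diag_tendsto]
  show ?thesis by (simp add: exp_minus divide_inverse)
qed

section \<open>Passing the inequalities to a weak limit\<close>

context
  fixes \<Lambda> :: "nat \<Rightarrow> complex set" and L :: "complex set" and A B :: real and n0 :: nat
  assumes fin: "\<And>n. finite (\<Lambda> n)" and lim: "weak_limit \<Lambda> L" and AB: "A > 0" "B > 0"
    and lower: "\<And>n p. n \<ge> n0 \<Longrightarrow> degree p \<le> n \<Longrightarrow>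
       A * (fock_norm (poly p))\<^sup>2 \<le> (\<Sum>l\<in>\<Lambda> n. (cmod (poly p l))\<^sup>2 / Re (poly_kernel n l l))"
    and upper: "\<And>n p. n \<ge> n0 \<Longrightarrow> degree p \<le> n \<Longrightarrow>
       (\<Sum>l\<in>\<Lambda> n. (cmod (poly p l))\<^sup>2 / Re (poly_kernel n l l)) \<le> B * (fock_norm (poly p))\<^sup>2"
begin

lemma quotient_nonneg: "0 \<le> (cmod u)\<^sup>2 / Re (poly_kernel n z z)"
  using Re_poly_kernel_diag_ge_1[of n z] by simp

text \<open>Each point of \<open>F\<close> gets its own nearby point of \<open>\<Lambda> n\<close>.
  The Taylor polynomials of \<open>f\<close> are the test functions: their quotients converge to the
  wanted terms, and by Parseval their norms do not exceed that of \<open>f\<close>.\<close>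

lemma weak_limit_finite_sum_le:
  assumes "f \<in> fock_space" "finite F" "F \<subseteq> L"
  shows "(\<Sum>l\<in>F. (cmod (f l))\<^sup>2 * exp (- pi * (cmod l)\<^sup>2)) \<le> B * (fock_norm f)\<^sup>2"
proof (rule field_le_epsilon)
  fix e :: real assume e: "e > 0"
  define c where "c k = (deriv ^^ k) f 0 / fact k" for k
  have f: "(\<lambda>k. c k * z ^ k) sums f z" for z
    unfolding c_def by (rule entire_taylor_sums) (use assms(1) in \<open>simp add: fock_space_def\<close>)
  \<comment> \<open>The error is shared among the points of \<open>F\<close>; the added 1 covers the
    empty set.\<close>
  define e' where "e' = e / real (card F + 1)"
  have e': "e' > 0" "real (card F) * e' \<le> e"
    using e by (auto simp: e'_def field_simps)
  let ?w = "\<lambda>l. (cmod (f l))\<^sup>2 * exp (- pi * (cmod l)\<^sup>2)"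
  let ?q = "\<lambda>n y. (cmod (poly (taylor_poly c n) y))\<^sup>2 / Re (poly_kernel n y y)"
  have "\<forall>l\<in>F. \<exists>d>0. \<forall>l'\<in>F. l' \<noteq> l \<longrightarrow> d \<le> dist l l'"
    using finite_set_avoid[OF assms(2)] by blast
  then obtain d where d: "\<And>l. l \<in> F \<Longrightarrow> d l > 0" "\<And>l l'. l \<in> F \<Longrightarrow> l' \<in> F \<Longrightarrow> l' \<noteq> l \<Longrightarrow> d l \<le> dist l l'"
    by metis
  have "\<forall>\<^sub>F n in sequentially. \<exists>y\<in>\<Lambda> n. dist y l < d l / 2 \<and> ?w l - e' < ?q n y" if l: "l \<in> F" for l
  proof (rule weak_limit_eventually_point[OF lim])
    show "l \<in> L" using l assms(3) by blast
    have "\<forall>\<^sub>F x in sequentially \<times>\<^sub>F nhds l. dist (snd x) l < d l / 2"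
      using d(1)[OF l] by (intro tendstoD filterlim_snd) auto
    moreover have "\<forall>\<^sub>F x in sequentially \<times>\<^sub>F nhds l. ?w l - e' < ?q (fst x) (snd x)"
      by (rule order_tendstoD(1)[OF taylor_poly_quotient_tendsto[OF f]]) (use e' in simp)
    ultimately show "\<forall>\<^sub>F x in sequentially \<times>\<^sub>F nhds l. dist (snd x) l < d l / 2 \<and> ?w l - e' < ?q (fst x) (snd x)"
      by eventually_elim simp
  qed
  then have "\<forall>\<^sub>F n in sequentially. \<forall>l\<in>F. \<exists>y\<in>\<Lambda> n. dist y l < d l / 2 \<and> ?w l - e' < ?q n y"
    using assms(2) by (simp add: eventually_ball_finite)
  then have "\<forall>\<^sub>F n in sequentially. n0 \<le> n \<and> (\<forall>l\<in>F. \<exists>y\<in>\<Lambda> n. dist y l < d l / 2 \<and> ?w l - e' < ?q n y)"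
    using eventually_ge_at_top by (rule eventually_conj[rotated])
  then obtain n where n: "n0 \<le> n" "\<forall>l\<in>F. \<exists>y\<in>\<Lambda> n. dist y l < d l / 2 \<and> ?w l - e' < ?q n y"
    unfolding eventually_sequentially by blast
  then obtain g where g: "\<And>l. l \<in> F \<Longrightarrow> g l \<in> \<Lambda> n" "\<And>l. l \<in> F \<Longrightarrow> dist (g l) l < d l / 2"
      "\<And>l. l \<in> F \<Longrightarrow> ?w l - e' < ?q n (g l)"
    by metis
  \<comment> \<open>The chosen points lie within half the separation, so none of them serves two
    points of \<open>F\<close>.\<close>
  have inj: "inj_on g F"
  proof (rule inj_onI, rule ccontr)
    fix l l' assume l: "l \<in> F" "l' \<in> F" "g l = g l'" "l \<noteq> l'"
    have "dist l l' < d l / 2 + d l' / 2"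
      using g(2)[OF l(1)] g(2)[OF l(2), folded l(3)] dist_triangle3[of l l' "g l"] by linarith
    then show False using d(2)[OF l(1,2)] d(2)[OF l(2,1)] l(4) by (auto simp: dist_commute)
  qed
  have "(\<Sum>l\<in>F. ?w l) - real (card F) * e' = (\<Sum>l\<in>F. ?w l - e')" by (simp add: sum_subtractf)
  also have "\<dots> \<le> (\<Sum>l\<in>F. ?q n (g l))" by (intro sum_mono less_imp_le g)
  also have "\<dots> = (\<Sum>y\<in>g ` F. ?q n y)" by (simp add: sum.reindex[OF inj])
  also have "\<dots> \<le> (\<Sum>y\<in>\<Lambda> n. ?q n y)"
    using g(1) by (intro sum_mono2 fin quotient_nonneg) auto
  also have "\<dots> \<le> B * (fock_norm (poly (taylor_poly c n)))\<^sup>2"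
    by (rule upper[OF n(1) degree_taylor_poly])
  also have "(fock_norm (poly (taylor_poly c n)))\<^sup>2 \<le> (fock_norm f)\<^sup>2"
    using fock_space_parseval[OF f assms(1)] unfolding fock_norm_taylor_poly sums_iff
    by (metis (no_types, lifting) finite_atMost sum_le_suminf divide_nonneg_nonneg fact_ge_zero
          mult_nonneg_nonneg pi_ge_zero zero_le_power zero_le_power2)
  finally show "(\<Sum>l\<in>F. ?w l) \<le> B * (fock_norm f)\<^sup>2 + e"
    using e'(2) AB by (simp add: mult_left_mono)
qed

lemma weak_limit_upper:
  assumes "f \<in> fock_space"
  shows "(\<lambda>l. (cmod (f l))\<^sup>2 * exp (- pi * (cmod l)\<^sup>2)) summable_on L" (is "?w summable_on L")
    and "(\<Sum>\<^sub>\<infinity>l\<in>L. (cmod (f l))\<^sup>2 * exp (- pi * (cmod l)\<^sup>2)) \<le> B * (fock_norm f)\<^sup>2"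
proof -
  show s: "?w summable_on L"
    by (rule nonneg_bdd_above_summable_on, simp, rule bdd_aboveI2)
       (rule weak_limit_finite_sum_le[OF assms], auto)
  show "(\<Sum>\<^sub>\<infinity>l\<in>L. ?w l) \<le> B * (fock_norm f)\<^sup>2"
    by (rule infsum_le_finite_sums[OF s weak_limit_finite_sum_le[OF assms]])
qed

text \<open>The test polynomials \<open>k\<^sub>n(\<sqdot>, w)\<close> show that at most \<open>2 B\<close> points of \<open>\<Lambda> n\<close> can
  merge at \<open>w\<close> in the limit.\<close>
lemma weak_limit_multiplicity:
  "\<exists>d>0. \<forall>\<^sub>F n in sequentially. real (card (\<Lambda> n \<inter> ball w d)) \<le> 2 * B"
proof -
  \<comment> \<open>Coefficients of \<open>exp (pi * cnj w * z)\<close> in \<open>z\<close>;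
    truncated at \<open>n\<close> they give \<open>poly_kernel n z w\<close>.\<close>
  define c where "c k = (of_real pi * cnj w) ^ k / fact k" for k
  let ?e = "exp (pi * (cmod w)\<^sup>2)"
  let ?q = "\<lambda>n y. (cmod (poly (taylor_poly c n) y))\<^sup>2 / Re (poly_kernel n y y)"
  have f: "(\<lambda>k. c k * z ^ k) sums exp (of_real pi * cnj w * z)" for z
    using exp_converges[of "of_real pi * cnj w * z"]
    by (simp add: c_def power_mult_distrib scaleR_conv_of_real divide_inverse mult_ac)
  have "of_real pi * cnj w * w = of_real (pi * (cmod w)\<^sup>2)"
    unfolding of_real_mult complex_norm_square by (simp add: mult_ac)
  then have "(cmod (exp (of_real pi * cnj w * w)))\<^sup>2 * exp (- pi * (cmod w)\<^sup>2) = ?e"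
    by (simp add: power2_eq_square exp_minus del: of_real_mult of_real_power)
  \<comment> \<open>The quotient tends to \<open>?e\<close>; settling for half of it is the origin
    of the 2 in \<open>2 * B\<close>.\<close>
  then have "\<forall>\<^sub>F x in sequentially \<times>\<^sub>F nhds w. ?e / 2 < ?q (fst x) (snd x)"
    by (intro order_tendstoD(1)[OF taylor_poly_quotient_tendsto[OF f]]) simp
  then obtain Q S where Q: "\<forall>\<^sub>F n in sequentially. Q n" "\<forall>\<^sub>F y in nhds w. S y" 
      "\<And>n y. Q n \<Longrightarrow> S y \<Longrightarrow> ?e / 2 < ?q n y"
    unfolding eventually_prod_filter by auto
  obtain d where d: "d > 0" "\<And>y. dist y w < d \<Longrightarrow> S y"
    using Q(2) unfolding eventually_nhds_metric by auto
  from Q(1) eventually_ge_at_top[of n0]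
  have "\<forall>\<^sub>F n in sequentially. real (card (\<Lambda> n \<inter> ball w d)) \<le> 2 * B"
  proof eventually_elim
    case (elim n)
    have "real (card (\<Lambda> n \<inter> ball w d)) * (?e / 2) = (\<Sum>y\<in>\<Lambda> n \<inter> ball w d. ?e / 2)" by simp
    also have "\<dots> \<le> (\<Sum>y\<in>\<Lambda> n \<inter> ball w d. ?q n y)"
      by (intro sum_mono less_imp_le Q(3) elim d(2)) (auto simp: dist_commute)
    also have "\<dots> \<le> (\<Sum>y\<in>\<Lambda> n. ?q n y)"
      by (intro sum_mono2 fin quotient_nonneg) auto
    also have "\<dots> \<le> B * (fock_norm (poly (taylor_poly c n)))\<^sup>2"
      by (rule upper[OF elim(2) degree_taylor_poly])
    \<comment> \<open>The reproducing property for the test polynomial: its squared norm is the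
      kernel at \<open>w\<close>.\<close>
    also have "(fock_norm (poly (taylor_poly c n)))\<^sup>2 = (\<Sum>k\<le>n. (pi * (cmod w)\<^sup>2) ^ k / fact k)"
      unfolding fock_norm_taylor_poly
      by (intro sum.cong refl)
         (simp add: c_def norm_divide norm_power norm_mult power_mult_distrib power_divide
           power2_eq_square field_simps)
    also have "\<dots> \<le> ?e" by (rule exp_partial_sum_le) simp
    finally show ?case using AB by (simp add: mult_left_mono field_simps)
  qed
  with d(1) show ?thesis by blast
qed

text \<open>The sum over \<open>\<Lambda> n\<close> is split at radius \<open>R\<close>. At most
  \<open>2 * B\<close> points merge at a limit point, whence the factor; the outside part is of
  order \<open>1 / R^2\<close> and disappears as \<open>R\<close> grows.\<close>

lemma weak_limit_lower_poly:
  "A * (fock_norm (poly p))\<^sup>2 \<le> 2 * B * (\<Sum>\<^sub>\<infinity>l\<in>L. (cmod (poly p l))\<^sup>2 * exp (- pi * (cmod l)\<^sup>2))"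
proof -
  let ?w = "\<lambda>l. (cmod (poly p l))\<^sup>2 * exp (- pi * (cmod l)\<^sup>2)"
  let ?S = "\<Sum>\<^sub>\<infinity>l\<in>L. ?w l"
  let ?Z = "B * (fock_norm (poly (monom 1 1 * p)))\<^sup>2"
  let ?q = "\<lambda>n y. (cmod (poly p y))\<^sup>2 / Re (poly_kernel n y y)"
  obtain d where d: "\<And>w. d w > 0" "\<And>w. \<forall>\<^sub>F n in sequentially. real (card (\<Lambda> n \<inter> ball w (d w))) \<le> 2 * B"
    using weak_limit_multiplicity by metis
  have finL: "finite (L \<inter> cball 0 r)" for r
    using weak_limit_upper(1)[OF poly_in_fock_space[of 1]] 
    by (intro finite_inter_cball_if_summable_gaussian) simp
  have inside: "A * (fock_norm (poly p))\<^sup>2 - ?Z / R\<^sup>2 \<le> 2 * B * ?S" if R: "R > 0" for R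
  proof (rule field_le_epsilon)
    fix e :: real assume e: "e > 0"
    let ?F = "L \<inter> cball 0 (R + 1)"
    define e' where "e' = e / (2 * B) / real (card ?F + 1)"
    have "2 * B * (real (card ?F) * e') = e * (real (card ?F) / real (card ?F + 1))"
      using AB by (simp add: e'_def)
    also have "\<dots> \<le> e" using e by (intro mult_left_le) auto
    finally have e': "e' > 0" "2 * B * (real (card ?F) * e') \<le> e"
      using e AB by (simp_all add: e'_def)
    let ?P = "\<lambda>w n y. dist y w < d w \<and> ?q n y < ?w w + e'"
    have P: "\<forall>\<^sub>F x in sequentially \<times>\<^sub>F nhds w. ?P w (fst x) (snd x)" for w
    proof -
      have "\<forall>\<^sub>F x in sequentially \<times>\<^sub>F nhds w. dist (snd x) w < d w"
        using d(1) by (intro tendstoD filterlim_snd) auto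
      moreover have "((\<lambda>x. ?q (fst x) (snd x)) \<longlongrightarrow> ?w w) (sequentially \<times>\<^sub>F nhds w)"
      proof -
        have "((\<lambda>x. poly p (snd x)) \<longlongrightarrow> poly p w) (sequentially \<times>\<^sub>F nhds w)"
          by (intro isCont_tendsto_compose[OF poly_isCont] filterlim_snd)
        from tendsto_divide[OF tendsto_power[OF tendsto_norm[OF this], of 2] Re_poly_kernel_diag_tendsto]
        show ?thesis by (simp add: exp_minus divide_inverse)
      qed
      then have "\<forall>\<^sub>F x in sequentially \<times>\<^sub>F nhds w. ?q (fst x) (snd x) < ?w w + e'"
        by (rule order_tendstoD(2)) (use e' in simp)
      ultimately show ?thesis by eventually_elim simp
    qed
    \<comment> \<open>The degree condition admits the product of \<open>p\<close> with
      \<open>z\<close>, used outside the disk.\<close>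
    have "\<forall>\<^sub>F n in sequentially. (\<forall>y\<in>\<Lambda> n \<inter> cball 0 R. \<exists>w\<in>?F. ?P w n y) \<and>
        (\<forall>w\<in>?F. real (card (\<Lambda> n \<inter> ball w (d w))) \<le> 2 * B) \<and> n \<ge> max n0 (degree p + 1)"
      by (intro eventually_conj weak_limit_eventually_cball[OF lim finL R P] eventually_ge_at_top
            eventually_ball_finite finL ballI d(2))
    then have "\<exists>n. (\<forall>y\<in>\<Lambda> n \<inter> cball 0 R. \<exists>w\<in>?F. ?P w n y) \<and>
        (\<forall>w\<in>?F. real (card (\<Lambda> n \<inter> ball w (d w))) \<le> 2 * B) \<and> n \<ge> max n0 (degree p + 1)"
      by (rule eventually_happens'[OF sequentially_bot])
    then obtain n where cover: "\<And>y. y \<in> \<Lambda> n \<inter> cball 0 R \<Longrightarrow> \<exists>w\<in>?F. ?P w n y"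
      and card: "\<And>w. w \<in> ?F \<Longrightarrow> real (card (\<Lambda> n \<inter> ball w (d w))) \<le> 2 * B"
      and n: "n \<ge> n0" "n \<ge> degree p + 1"
      unfolding max.bounded_iff by blast
    have outside: "(\<Sum>y\<in>\<Lambda> n - cball 0 R. ?q n y) \<le> ?Z / R\<^sup>2"
    proof -
      have "(\<Sum>y\<in>\<Lambda> n - cball 0 R. ?q n y)
          \<le> (\<Sum>y\<in>\<Lambda> n - cball 0 R. (cmod (poly (monom 1 1 * p) y))\<^sup>2 / Re (poly_kernel n y y) / R\<^sup>2)"
      proof (rule sum_mono)
        fix y assume "y \<in> \<Lambda> n - cball 0 R"
        then have "(cmod (poly p y))\<^sup>2 \<le> (cmod (poly (monom 1 1 * p) y))\<^sup>2 / R\<^sup>2"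
          using norm_poly_le_monom_mult[OF R, of y p 1] by simp
        moreover have "0 \<le> Re (poly_kernel n y y)"
          by (rule order_trans[OF zero_le_one Re_poly_kernel_diag_ge_1])
        ultimately have "?q n y \<le> (cmod (poly (monom 1 1 * p) y))\<^sup>2 / R\<^sup>2 / Re (poly_kernel n y y)"
          by (rule divide_right_mono)
        then show "?q n y \<le> (cmod (poly (monom 1 1 * p) y))\<^sup>2 / Re (poly_kernel n y y) / R\<^sup>2"
          by (simp only: divide_divide_eq_left mult.commute)
      qed
      also have "\<dots> \<le> (\<Sum>y\<in>\<Lambda> n. (cmod (poly (monom 1 1 * p) y))\<^sup>2 / Re (poly_kernel n y y) / R\<^sup>2)"
        using fin by (intro sum_mono2 divide_nonneg_nonneg quotient_nonneg) auto
      also have "\<dots> \<le> ?Z / R\<^sup>2"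
        unfolding sum_divide_distrib[symmetric]
        using n degree_mult_le[of "monom (1::complex) 1" p] degree_monom_le[of "1::complex" 1]
        by (intro divide_right_mono upper) auto
      finally show ?thesis .
    qed
    \<comment> \<open>Every point is charged to all limit points near it; exchanging the sums then
      counts the points at each limit point.\<close>
    have "(\<Sum>y\<in>\<Lambda> n \<inter> cball 0 R. ?q n y) \<le> (\<Sum>y\<in>\<Lambda> n \<inter> cball 0 R. \<Sum>w\<in>?F. if ?P w n y then ?w w + e' else 0)"
    proof (rule sum_mono)
      fix y assume "y \<in> \<Lambda> n \<inter> cball 0 R"
      then obtain w where w: "w \<in> ?F" "?P w n y" using cover by blast
      then have "?q n y \<le> (if ?P w n y then ?w w + e' else 0)" by simp
      also have "\<dots> \<le> (\<Sum>w\<in>?F. if ?P w n y then ?w w + e' else 0)"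
        using w(1) e'(1) by (intro member_le_sum finL) auto
      finally show "?q n y \<le> (\<Sum>w\<in>?F. if ?P w n y then ?w w + e' else 0)" .
    qed
    also have "\<dots> = (\<Sum>w\<in>?F. \<Sum>y\<in>\<Lambda> n \<inter> cball 0 R. if ?P w n y then ?w w + e' else 0)"
      by (rule sum.swap)
    also have "\<dots> \<le> (\<Sum>w\<in>?F. 2 * B * (?w w + e'))"
    proof (rule sum_mono)
      fix w assume w: "w \<in> ?F"
      have "(\<Sum>y\<in>\<Lambda> n \<inter> cball 0 R. if ?P w n y then ?w w + e' else 0)
          \<le> (\<Sum>y\<in>\<Lambda> n \<inter> cball 0 R. if y \<in> ball w (d w) then ?w w + e' else 0)"
        using e'(1) by (intro sum_mono) (simp add: dist_commute)
      also have "\<dots> \<le> (\<Sum>y\<in>\<Lambda> n. if y \<in> ball w (d w) then ?w w + e' else 0)"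
        using e'(1) by (intro sum_mono2 fin) auto
      also have "\<dots> = real (card (\<Lambda> n \<inter> ball w (d w))) * (?w w + e')"
        using fin by (subst sum.inter_restrict[symmetric]) auto
      also have "\<dots> \<le> 2 * B * (?w w + e')"
        using card[OF w] e'(1) by (intro mult_right_mono) auto
      finally show "(\<Sum>y\<in>\<Lambda> n \<inter> cball 0 R. if ?P w n y then ?w w + e' else 0) \<le> 2 * B * (?w w + e')" .
    qed
    also have "\<dots> = 2 * B * (\<Sum>w\<in>?F. ?w w) + 2 * B * (real (card ?F) * e')"
      by (simp add: sum_distrib_left[symmetric] sum.distrib algebra_simps)
    also have "\<dots> \<le> 2 * B * ?S + e"
      using AB e'(2) finL weak_limit_upper(1)[OF poly_in_fock_space]
      by (intro add_mono mult_left_mono finite_sum_le_infsum) auto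
    finally have "(\<Sum>y\<in>\<Lambda> n \<inter> cball 0 R. ?q n y) \<le> 2 * B * ?S + e" .
    moreover have "(\<Sum>y\<in>\<Lambda> n. ?q n y) = (\<Sum>y\<in>\<Lambda> n \<inter> cball 0 R. ?q n y) + (\<Sum>y\<in>\<Lambda> n - cball 0 R. ?q n y)"
      by (rule sum.Int_Diff[OF fin])
    moreover have "A * (fock_norm (poly p))\<^sup>2 \<le> (\<Sum>y\<in>\<Lambda> n. ?q n y)"
      using n by (intro lower) auto
    ultimately show "A * (fock_norm (poly p))\<^sup>2 - ?Z / R\<^sup>2 \<le> 2 * B * ?S + e"
      using outside by linarith
  qed
  have "((\<lambda>R. A * (fock_norm (poly p))\<^sup>2 - ?Z / R\<^sup>2) \<longlongrightarrow> A * (fock_norm (poly p))\<^sup>2 - 0) at_top"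
    by (intro tendsto_diff tendsto_const tendsto_divide_0[OF tendsto_const] filterlim_at_top_imp_at_infinity
          filterlim_pow_at_top filterlim_ident) simp
  then show ?thesis
    using inside by (intro tendsto_upperbound[of _ _ at_top])
      (auto intro: eventually_mono[OF eventually_gt_at_top[of 0]])
qed

text \<open>The Taylor remainder is absorbed by the upper inequality, since its norm tends to 0.
  Bounding the square of a difference by twice the sum of the squares doubles the constant to
  \<open>4 * B\<close>.\<close>

lemma weak_limit_lower:
  assumes "f \<in> fock_space"
  shows "A * (fock_norm f)\<^sup>2 \<le> 4 * B * (\<Sum>\<^sub>\<infinity>l\<in>L. (cmod (f l))\<^sup>2 * exp (- pi * (cmod l)\<^sup>2))"
proof -
  let ?w = "\<lambda>f l. (cmod (f l))\<^sup>2 * exp (- pi * (cmod l)\<^sup>2)"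
  let ?a = "\<lambda>k c. (cmod (c k))\<^sup>2 * (fact k / pi ^ k)"
  define c where "c k = (deriv ^^ k) f 0 / fact k" for k
  have f: "(\<lambda>k. c k * z ^ k) sums f z" for z
    unfolding c_def by (rule entire_taylor_sums) (use assms in \<open>simp add: fock_space_def\<close>)
  have norm_f: "(\<lambda>k. ?a k c) sums (fock_norm f)\<^sup>2" by (rule fock_space_parseval[OF f assms])
  define P where "P N = poly (taylor_poly c N)" for N
  define r where "r N = (\<lambda>z. f z - P N z)" for N
  have P: "P N \<in> fock_space" for N unfolding P_def by (rule poly_in_fock_space)
  have P_norm: "(\<lambda>N. (fock_norm (P N))\<^sup>2) \<longlonglongrightarrow> (fock_norm f)\<^sup>2"
    using norm_f by (simp add: P_def fock_norm_taylor_poly sums_def_le)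
  have r_sums: "(\<lambda>k. (c k - coeff (taylor_poly c N) k) * z ^ k) sums r N z" for N z
    using sums_diff[OF f coeff_sums_poly[of "taylor_poly c N"]] by (simp add: r_def P_def left_diff_distrib)
  \<comment> \<open>Up to degree \<open>N\<close> the coefficients cancel, above it those of the
    polynomial vanish, so the squared moduli subtract termwise.\<close>
  have r_norm_sums: "(\<lambda>k. ?a k (\<lambda>k. c k - coeff (taylor_poly c N) k)) sums ((fock_norm f)\<^sup>2 - (fock_norm (P N))\<^sup>2)" for N
  proof -
    have "(\<lambda>k. ?a k (coeff (taylor_poly c N))) sums (fock_norm (P N))\<^sup>2"
      unfolding P_def by (rule fock_space_parseval[OF coeff_sums_poly poly_in_fock_space])
    from sums_diff[OF norm_f this] show ?thesis
      by (rule sums_cong[THEN iffD1, rotated]) (simp add: coeff_taylor_poly)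
  qed
  have r: "r N \<in> fock_space" for N
    by (rule fock_spaceI[OF r_sums sums_summable[OF r_norm_sums]])
  have r_norm: "(fock_norm (r N))\<^sup>2 = (fock_norm f)\<^sup>2 - (fock_norm (P N))\<^sup>2" for N
    using fock_space_parseval[OF r_sums r] r_norm_sums by (rule sums_unique2)
  let ?S = "\<Sum>\<^sub>\<infinity>l\<in>L. ?w f l"
  have "A * (fock_norm (P N))\<^sup>2 \<le> 2 * B * (2 * ?S + 2 * (B * ((fock_norm f)\<^sup>2 - (fock_norm (P N))\<^sup>2)))" for N
  proof -
    have "(\<Sum>\<^sub>\<infinity>l\<in>L. ?w (P N) l) \<le> (\<Sum>\<^sub>\<infinity>l\<in>L. 2 * ?w f l + 2 * ?w (r N) l)"
    proof (rule infsum_mono)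
      show "?w (P N) summable_on L" by (rule weak_limit_upper(1)[OF P])
      show "(\<lambda>l. 2 * ?w f l + 2 * ?w (r N) l) summable_on L"
        by (intro summable_on_add summable_on_cmult_right weak_limit_upper(1) assms r)
      fix l
      have "cmod (P N l) \<le> cmod (f l) + cmod (r N l)"
        using norm_triangle_ineq4[of "f l" "r N l"] by (simp add: r_def)
      then have "(cmod (P N l))\<^sup>2 \<le> (cmod (f l) + cmod (r N l))\<^sup>2" by (intro power_mono) auto
      also have "\<dots> \<le> 2 * (cmod (f l))\<^sup>2 + 2 * (cmod (r N l))\<^sup>2"
        using sum_squares_bound[of "cmod (f l)" "cmod (r N l)"] by (simp add: power2_sum)
      finally have "(cmod (P N l))\<^sup>2 \<le> 2 * (cmod (f l))\<^sup>2 + 2 * (cmod (r N l))\<^sup>2" .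
      from mult_right_mono[OF this, of "exp (- pi * (cmod l)\<^sup>2)"]
      show "?w (P N) l \<le> 2 * ?w f l + 2 * ?w (r N) l" by (simp add: distrib_right mult.assoc)
    qed
    also have "\<dots> = 2 * ?S + 2 * (\<Sum>\<^sub>\<infinity>l\<in>L. ?w (r N) l)"
      unfolding infsum_cmult_right'[symmetric]
      by (intro infsum_add summable_on_cmult_right weak_limit_upper(1) assms r)
    also have "\<dots> \<le> 2 * ?S + 2 * (B * (fock_norm (r N))\<^sup>2)"
      using weak_limit_upper(2)[OF r[of N]] by simp
    finally have *: "(\<Sum>\<^sub>\<infinity>l\<in>L. ?w (P N) l) \<le> 2 * ?S + 2 * (B * (fock_norm (r N))\<^sup>2)" .
    have "A * (fock_norm (P N))\<^sup>2 \<le> 2 * B * (\<Sum>\<^sub>\<infinity>l\<in>L. ?w (P N) l)"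
      unfolding P_def by (rule weak_limit_lower_poly)
    also have "\<dots> \<le> 2 * B * (2 * ?S + 2 * (B * (fock_norm (r N))\<^sup>2))"
      using * AB by (intro mult_left_mono) auto
    finally show ?thesis by (simp add: r_norm)
  qed
  moreover have "(\<lambda>N. A * (fock_norm (P N))\<^sup>2) \<longlonglongrightarrow> A * (fock_norm f)\<^sup>2"
    by (intro tendsto_intros P_norm)
  moreover have "(\<lambda>N. 2 * B * (2 * ?S + 2 * (B * ((fock_norm f)\<^sup>2 - (fock_norm (P N))\<^sup>2))))
      \<longlonglongrightarrow> 2 * B * (2 * ?S + 2 * (B * ((fock_norm f)\<^sup>2 - (fock_norm f)\<^sup>2)))"
    by (intro tendsto_intros P_norm)
  ultimately have "A * (fock_norm f)\<^sup>2 \<le> 2 * B * (2 * ?S + 2 * (B * ((fock_norm f)\<^sup>2 - (fock_norm f)\<^sup>2)))"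
    by (intro LIMSEQ_le) auto
  then show ?thesis by simp
qed

end

text \<open>The upper constant survives the limit, while the lower one becomes
  \<open>A / (4 * B)\<close>, because one limit point may stand for several merged points.\<close>

lemma weak_limit_marcinkiewicz_zygmund_sampling:
  assumes "marcinkiewicz_zygmund \<Lambda>" "weak_limit \<Lambda> L"
  shows "sampling_set L"
proof -
  obtain A B n0 where fin: "\<And>n. finite (\<Lambda> n)" and AB: "A > 0" "B > 0"
    and *: "\<And>n p. n \<ge> n0 \<Longrightarrow> p \<in> poly_space n \<Longrightarrow>
        A * (fock_norm p)\<^sup>2 \<le> (\<Sum>l\<in>\<Lambda> n. (cmod (p l))\<^sup>2 / Re (poly_kernel n l l)) \<and>
        (\<Sum>l\<in>\<Lambda> n. (cmod (p l))\<^sup>2 / Re (poly_kernel n l l)) \<le> B * (fock_norm p)\<^sup>2"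
    using assms(1) unfolding marcinkiewicz_zygmund_def by blast
  have mz: "n \<ge> n0 \<Longrightarrow> degree p \<le> n \<Longrightarrow>
       A * (fock_norm (poly p))\<^sup>2 \<le> (\<Sum>l\<in>\<Lambda> n. (cmod (poly p l))\<^sup>2 / Re (poly_kernel n l l))"
    "n \<ge> n0 \<Longrightarrow> degree p \<le> n \<Longrightarrow>
       (\<Sum>l\<in>\<Lambda> n. (cmod (poly p l))\<^sup>2 / Re (poly_kernel n l l)) \<le> B * (fock_norm (poly p))\<^sup>2" for n p
    using *[of n "poly p"] by (auto simp: poly_space_def)
  note facts = fin assms(2) AB mz
  have "\<forall>f\<in>fock_space.
     (\<lambda>l. (cmod (f l))\<^sup>2 * exp (- pi * (cmod l)\<^sup>2)) summable_on L \<and>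
     A / (4 * B) * (fock_norm f)\<^sup>2 \<le> (\<Sum>\<^sub>\<infinity>l\<in>L. (cmod (f l))\<^sup>2 * exp (- pi * (cmod l)\<^sup>2)) \<and>
     (\<Sum>\<^sub>\<infinity>l\<in>L. (cmod (f l))\<^sup>2 * exp (- pi * (cmod l)\<^sup>2)) \<le> B * (fock_norm f)\<^sup>2"
  proof (intro ballI conjI)
    fix f assume f: "f \<in> fock_space"
    show "(\<lambda>l. (cmod (f l))\<^sup>2 * exp (- pi * (cmod l)\<^sup>2)) summable_on L"
      by (rule weak_limit_upper(1)[OF facts f])
    show "(\<Sum>\<^sub>\<infinity>l\<in>L. (cmod (f l))\<^sup>2 * exp (- pi * (cmod l)\<^sup>2)) \<le> B * (fock_norm f)\<^sup>2"
      by (rule weak_limit_upper(2)[OF facts f])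
    show "A / (4 * B) * (fock_norm f)\<^sup>2 \<le> (\<Sum>\<^sub>\<infinity>l\<in>L. (cmod (f l))\<^sup>2 * exp (- pi * (cmod l)\<^sup>2))"
      using weak_limit_lower[OF facts f] AB by (simp add: field_simps)
  qed
  moreover have "A / (4 * B) > 0" using AB by simp
  ultimately show ?thesis unfolding sampling_set_def using AB(2) by blast
qed

theorem theorem1p1:
  shows "(\<forall>\<Lambda>::complex set. sampling_set \<Lambda> \<longrightarrow>
            (\<exists>\<tau>0>0. \<forall>\<tau>\<ge>\<tau>0. \<forall>\<rho>::nat \<Rightarrow> real.
               (\<forall>n\<ge>1. \<rho> n > 0 \<and> pi * (\<rho> n)\<^sup>2 = real n + sqrt (real n) * \<tau>) \<longrightarrow>
               marcinkiewicz_zygmund (\<lambda>n. \<Lambda> \<inter> cball 0 (\<rho> n))))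
       \<and> (\<forall>(\<Lambda>::nat \<Rightarrow> complex set) (L::complex set).
            marcinkiewicz_zygmund \<Lambda> \<longrightarrow> weak_limit \<Lambda> L \<longrightarrow> sampling_set L)"
  using sampling_set_inter_disks_marcinkiewicz_zygmund weak_limit_marcinkiewicz_zygmund_sampling by blast

end
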